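(* Let $N\ge1$, let $\Delta$ be a constant and let $M_t$ ($t\in\mathbb Z$) satisfy $\Delta\le M_{t+1}$ for all $t\in\mathbb Z$. Let $P_i$ and $W_i$, $i=0,1,\dots,N-1$, be constants with $P_0\le P_1\le\dots\le P_{N-1}$. For $k\in\{0,1\}$, $t\in\mathbb Z$ and $n=1,2,\dots,N$ define $$T^{k,t}_n=\min_{0\le r_0<r_1<\dots<r_{n-1}\le N-1}\Bigg(\sum_{i=0}^{n-1}\Big(W_{r_i}+\big(2(n-1-i)-1\big)P_{r_i}-\big(2(n-1)+t+k\big)\min(P_{r_i},\Delta)+\sum_{j=0}^{t}\min(P_{r_i},M_j)\Big)\Bigg),$$ $$\overline T^{k,t}_n=\min_{0\le r_0<r_1<\dots<r_{n-1}\le N-1}\Bigg(\sum_{i=0}^{n-1}\Big(W_{r_i}+2(n-1-i)P_{r_i}-\big(2(n-1)+t+k\big)\min(P_{r_i},\Delta)+\sum_{j=0}^{t-1}\min(P_{r_i},M_j)\Big)\Bigg),$$ and set $$T^{k,t}_{-1}=T^{k,t}_{N+1}=\overline T^{k,t}_{-1}=\overline T^{k,t}_{N+1}=+\infty,\qquad T^{k,t}_0=\overline T^{k,t}_0=0.$$ Then $$Q^{(t)}_n=\overline T^{0,t+1}_{n+1}-\overline T^{0,t+1}_n+T^{1,t}_n-T^{1,t}_{n+1},\qquad \overline Q^{(t)}_n=\overline T^{0,t+1}_{n+1}-\overline T^{0,t+1}_n+\overline T^{1,t}_n-\overline T^{1,t}_{n+1},$$ $$E^{(t)}_n=T^{0,t}_{n+1}-T^{0,t}_n+\overline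 T^{1,t+1}_{n-1}-\overline T^{1,t+1}_n+2\Delta,\qquad \overline E^{(t)}_n=\overline T^{0,t}_{n+1}-\overline T^{0,t}_n+\overline T^{1,t+1}_{n-1}-\overline T^{1,t+1}_n+2\Delta,$$ $$\overline C^{(t)}_n=\overline T^{0,t}_n-\overline T^{0,t+1}_n+T^{1,t}_n-T^{1,t-1}_n+\Delta,\qquad \overline D^{(t)}_n=T^{0,t}_{n+1}-\overline T^{0,t+1}_n+\overline T^{1,t}_n-T^{1,t-1}_{n+1}$$ is a particular solution to the following ultradiscrete system (for all $t\in\mathbb Z$): $$\overline Q^{(t+1)}_n=\min\left(E^{(t)}_{n+1}-\max(0,\Delta-\overline D^{(t+1)}_n),\ \overline D^{(t+1)}_n\right),\qquad 0\le n\le N-1,$$ $$\overline E^{(t+1)}_n=E^{(t)}_n-\overline Q^{(t+1)}_{n-1}+Q^{(t)}_n-\max(0,\Delta-\overline D^{(t+1)}_{n-1})+\max(0,\Delta-\overline D^{(t+1)}_n),\qquad 1\le n\le N-1,$$ $$\overline C^{(t+1)}_n=\min(\overline D^{(t+1)}_{n-1}-\overline Q^{(t+1)}_{n-1}+\Delta,\ M_{t+1}),\qquad 1\le n\le N,$$ $$\overline D^{(t+1)}_n=\min(\overline C^{(t+1)}_n+Q^{(t)}_n-\Delta,\ M_{t+1}),\qquad 0\le n\le N-1,$$ $$Q^{(t+1)}_n=Q^{(t)}_n+\overline C^{(t+1)}_n-\overline C^{(t+1)}_{n+1},\qquad 0\le n\le N-1,$$ $$E^{(t+1)}_n=\overline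 E^{(t+1)}_n+\overline Q^{(t+1)}_{n-1}-Q^{(t)}_n-\overline D^{(t+1)}_{n-1}+\overline D^{(t+1)}_n,\qquad 1\le n\le N-1,$$ $$E^{(t)}_0=E^{(t)}_N=\overline E^{(t)}_0=\overline E^{(t)}_N=+\infty,\qquad \overline C^{(t+1)}_0=\Delta .$$
   Context: All constants $\Delta,P_i,W_i$ are real numbers, and each $M_t$ is a real number or $+\infty$. The superscripts $k,t$ and overlines are labels (not powers or conjugation). The variables $Q^{(t)}_n,\overline Q^{(t)}_n,\overline D^{(t)}_n$ are considered for $0\le n\le N-1$, and $E^{(t)}_n,\overline E^{(t)}_n,\overline C^{(t)}_n$ for $0\le n\le N$; the value $+\infty$ follows the usual conventions ($+\infty$ plus or minus a finite number is $+\infty$, and $\min(+\infty,a)=a$). Sums with upper limit less than the lower limit follow the usual convention: $\sum_{j=0}^{-1}a_j=0$ and $\sum_{j=0}^{t}a_j=-\sum_{j=t+1}^{-1}a_j$ for $t<-1$. *)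

theory Defs
  imports Complex_Main "HOL-Library.Extended_Real" "HOL-Library.FuncSet"
begin

text \<open>The sum over \<open>j = 0, \<dots>, t\<close> for an arbitrary integer upper limit, with
  \<open>\<Sum>\<^bsub>j=0\<^esub>\<^bsup>-1\<^esup> a j = 0\<close> and \<open>\<Sum>\<^bsub>j=0\<^esub>\<^bsup>t\<^esup> a j = - \<Sum>\<^bsub>j=t+1\<^esub>\<^bsup>-1\<^esup> a j\<close> for \<open>t < -1\<close>.\<close>

definition sum_upto :: "(int \<Rightarrow> real) \<Rightarrow> int \<Rightarrow> real" where
  "sum_upto a t = (if t \<ge> -1 then \<Sum>j\<in>{0..t}. a j else - (\<Sum>j\<in>{t+1..-1}. a j))"

text \<open>Minimum of a finite real and a bound that is real or \<open>\<infinity>\<close>; the result is a finite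
  real, so \<open>real_of_ereal\<close> is applied to a finite value only.\<close>

definition rmin :: "real \<Rightarrow> ereal \<Rightarrow> real" where
  "rmin p m = real_of_ereal (min (ereal p) m)"

definition choices :: "nat \<Rightarrow> nat \<Rightarrow> (nat \<Rightarrow> nat) set" where
  "choices N n = {r \<in> {..<n} \<rightarrow>\<^sub>E {..<N}. strict_mono_on {..<n} r}"

definition Tmin ::
  "nat \<Rightarrow> real \<Rightarrow> (int \<Rightarrow> ereal) \<Rightarrow> (nat \<Rightarrow> real) \<Rightarrow> (nat \<Rightarrow> real) \<Rightarrow> int \<Rightarrow> int \<Rightarrow> nat \<Rightarrow> real" where
  "Tmin N \<Delta> M P W k t n =
     Min ((\<lambda>r. \<Sum>i<n. W (r i) + (2 * (real n - 1 - real i) - 1) * P (r i)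
                 - (2 * (real n - 1) + of_int t + of_int k) * min (P (r i)) \<Delta>
                 + sum_upto (\<lambda>j. rmin (P (r i)) (M j)) t)
          ` choices N n)"

definition Tbarmin ::
  "nat \<Rightarrow> real \<Rightarrow> (int \<Rightarrow> ereal) \<Rightarrow> (nat \<Rightarrow> real) \<Rightarrow> (nat \<Rightarrow> real) \<Rightarrow> int \<Rightarrow> int \<Rightarrow> nat \<Rightarrow> real" where
  "Tbarmin N \<Delta> M P W k t n =
     Min ((\<lambda>r. \<Sum>i<n. W (r i) + 2 * (real n - 1 - real i) * P (r i)
                 - (2 * (real n - 1) + of_int t + of_int k) * min (P (r i)) \<Delta>
                 + sum_upto (\<lambda>j. rmin (P (r i)) (M j)) (t - 1))
          ` choices N n)"

text \<open>Only the indices \<open>-1 \<le> n \<le> N + 1\<close> are relevant, so the last branch covers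
  exactly \<open>n = -1\<close> and \<open>n = N + 1\<close>.\<close>

definition T ::
  "nat \<Rightarrow> real \<Rightarrow> (int \<Rightarrow> ereal) \<Rightarrow> (nat \<Rightarrow> real) \<Rightarrow> (nat \<Rightarrow> real) \<Rightarrow> int \<Rightarrow> int \<Rightarrow> int \<Rightarrow> ereal" where
  "T N \<Delta> M P W k t n =
     (if 1 \<le> n \<and> n \<le> int N then ereal (Tmin N \<Delta> M P W k t (nat n))
      else if n = 0 then 0 else \<infinity>)"

definition Tbar ::
  "nat \<Rightarrow> real \<Rightarrow> (int \<Rightarrow> ereal) \<Rightarrow> (nat \<Rightarrow> real) \<Rightarrow> (nat \<Rightarrow> real) \<Rightarrow> int \<Rightarrow> int \<Rightarrow> int \<Rightarrow> ereal" where
  "Tbar N \<Delta> M P W k t n =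
     (if 1 \<le> n \<and> n \<le> int N then ereal (Tbarmin N \<Delta> M P W k t (nat n))
      else if n = 0 then 0 else \<infinity>)"

text \<open>The ultradiscrete system; the families are indexed by the time \<open>t\<close> first and the site
  \<open>n\<close> second, and are constrained only on \<open>0 \<le> n \<le> N - 1\<close> (for \<open>Q\<close>, \<open>Qb\<close>, \<open>Db\<close>) and
  \<open>0 \<le> n \<le> N\<close> (for \<open>E\<close>, \<open>Eb\<close>, \<open>Cb\<close>).\<close>

definition ud_system ::
  "nat \<Rightarrow> real \<Rightarrow> (int \<Rightarrow> ereal) \<Rightarrow>
   (int \<Rightarrow> int \<Rightarrow> ereal) \<Rightarrow> (int \<Rightarrow> int \<Rightarrow> ereal) \<Rightarrow> (int \<Rightarrow> int \<Rightarrow> ereal) \<Rightarrow>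
   (int \<Rightarrow> int \<Rightarrow> ereal) \<Rightarrow> (int \<Rightarrow> int \<Rightarrow> ereal) \<Rightarrow> (int \<Rightarrow> int \<Rightarrow> ereal) \<Rightarrow> bool" where
  "ud_system N \<Delta> M Q Qb E Eb Cb Db \<longleftrightarrow>
    (\<forall>t.
      (\<forall>n. 0 \<le> n \<and> n \<le> int N - 1 \<longrightarrow>
         Qb (t+1) n = min (E t (n+1) - max 0 (ereal \<Delta> - Db (t+1) n)) (Db (t+1) n)) \<and>
      (\<forall>n. 1 \<le> n \<and> n \<le> int N - 1 \<longrightarrow>
         Eb (t+1) n = E t n - Qb (t+1) (n-1) + Q t n
                      - max 0 (ereal \<Delta> - Db (t+1) (n-1)) + max 0 (ereal \<Delta> - Db (t+1) n)) \<and>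
      (\<forall>n. 1 \<le> n \<and> n \<le> int N \<longrightarrow>
         Cb (t+1) n = min (Db (t+1) (n-1) - Qb (t+1) (n-1) + ereal \<Delta>) (M (t+1))) \<and>
      (\<forall>n. 0 \<le> n \<and> n \<le> int N - 1 \<longrightarrow>
         Db (t+1) n = min (Cb (t+1) n + Q t n - ereal \<Delta>) (M (t+1))) \<and>
      (\<forall>n. 0 \<le> n \<and> n \<le> int N - 1 \<longrightarrow>
         Q (t+1) n = Q t n + Cb (t+1) n - Cb (t+1) (n+1)) \<and>
      (\<forall>n. 1 \<le> n \<and> n \<le> int N - 1 \<longrightarrow>
         E (t+1) n = Eb (t+1) n + Qb (t+1) (n-1) - Q t n - Db (t+1) (n-1) + Db (t+1) n) \<and>
      E t 0 = \<infinity> \<and> E t (int N) = \<infinity> \<and> Eb t 0 = \<infinity> \<and> Eb t (int N) = \<infinity> \<and>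
      Cb (t+1) 0 = ereal \<Delta>)"

end

theory Submission
  imports Defs "HOL-Library.Ramsey"
begin

text \<open>
  The minima \<open>T\<close> and \<open>Tbar\<close> are ultradiscrete limits of Hankel-type sums
  \<open>\<Sum>\<^bsub>|R| = k\<^esub> \<Prod>\<^bsub>i\<in>R\<^esub> w i \<cdot> (squared Vandermonde of x on R)\<close> with
  \<open>x i = 1 / (p i + \<delta>)\<close>, where \<open>p, \<delta>, m\<close> correspond to \<open>P, \<Delta>, M\<close>. All the \<open>T\<close> entering the
  system at one time step arise from one base weight multiplied by some of the factors
  \<open>1/(p+\<delta>)\<close>, \<open>p/(p+\<delta>)\<close>, \<open>(p+m)/(p+\<delta>)\<close>, which are all linear in \<open>x\<close>. In a product of two such
  sums over \<open>R\<close> and \<open>S\<close>, Lagrange interpolation turns a sum over points of \<open>S\<close> into one over the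
  zeros of the factors, while moving a point from \<open>S\<close> to \<open>R\<close> turns it into a product of sums over
  sets of sizes \<open>k + 1\<close> and \<open>l - 1\<close>. This yields five bilinear identities whose coefficients
  \<open>\<delta>, m, \<delta> - m\<close> are positive. Comparing growth rates in \<open>u\<close> for \<open>p \<sim> u\<^sup>-\<^sup>P\<close>, \<open>\<delta> \<sim> u\<^sup>-\<^sup>\<Delta>\<close>,
  \<open>m \<sim> u\<^sup>-\<^sup>M\<close> gives five min-plus identities; two equations of the system hold identically, and
  the other four follow from these.
\<close>

section \<open>Lagrange interpolation and weighted Vandermonde sums\<close>

text \<open>This is the divided difference of the constant 1. For distinct \<open>a\<close>,
  \<open>b\<close> in \<open>V\<close> the factor \<open>b - a\<close> is
  \<open>(v - a) - (v - b)\<close>; each part deletes one node, and by induction both shortened sums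
  agree, so their difference vanishes.\<close>

lemma lagrange_sum_const:
  fixes V :: "'a::field set"
  assumes "finite V" "V \<noteq> {}"
  shows "(\<Sum>v\<in>V. 1 / (\<Prod>u\<in>V - {v}. v - u)) = (if card V = 1 then 1 else 0)"
  using assms
proof (induction "card V" arbitrary: V rule: less_induct)
  case less
  show ?case
  proof (cases "card V = 1")
    case True
    then show ?thesis by (auto simp: card_1_singleton_iff)
  next
    case False
    \<comment> \<open>The factor \<open>v - a\<close> kills the summand at \<open>a\<close> and
      cancels against the denominator elsewhere, so \<open>a\<close> disappears as a node.\<close>
    have del: "(\<Sum>v\<in>V. (v - a) / (\<Prod>u\<in>V - {v}. v - u))
        = (\<Sum>v\<in>V - {a}. 1 / (\<Prod>u\<in>V - {a} - {v}. v - u))" if "a \<in> V" for a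
    proof -
      have "(v - a) / (\<Prod>u\<in>V - {v}. v - u) = 1 / (\<Prod>u\<in>V - {a} - {v}. v - u)"
        if "v \<in> V - {a}" for v
      proof -
        have "V - {v} = insert a (V - {a} - {v})" using that \<open>a \<in> V\<close> by auto
        then show ?thesis using that less.prems by (simp add: prod.insert_remove)
      qed
      then show ?thesis using \<open>a \<in> V\<close> less.prems by (simp add: sum.remove[of V a])
    qed
    have "card V > 0" using less.prems by (simp add: card_gt_0_iff)
    then have c2: "2 \<le> card V" using False by simp
    then obtain a b where ab: "a \<in> V" "b \<in> V" "a \<noteq> b"
      by (metis card_le_Suc0_iff_eq less.prems(1) not_less_eq_eq numeral_2_eq_2)
    have same: "(\<Sum>v\<in>V - {c}. 1 / (\<Prod>u\<in>V - {c} - {v}. v - u)) = (if card V = 2 then 1 else 0)"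
      if "c \<in> V" for c
    proof -
      have "card (V - {c}) = card V - 1" using that less.prems by simp
      moreover have "V - {c} \<noteq> {}" using c2 that calculation by fastforce
      ultimately show ?thesis using less.hyps[of "V - {c}"] less.prems c2 by auto
    qed
    have "(b - a) * (\<Sum>v\<in>V. 1 / (\<Prod>u\<in>V - {v}. v - u))
        = (\<Sum>v\<in>V. (v - a) / (\<Prod>u\<in>V - {v}. v - u)) - (\<Sum>v\<in>V. (v - b) / (\<Prod>u\<in>V - {v}. v - u))"
      by (simp add: sum_distrib_left flip: sum_subtractf diff_divide_distrib)
    also have "\<dots> = 0" using same del ab by simp
    finally show ?thesis using ab False by simp
  qed
qed

text \<open>The divided difference of a monic polynomial of degree \<open>card A\<close> is zero
  below the top degree and the leading coefficient at it. The zeros form an indexed family, so they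
  may coincide. The induction splits \<open>v - y a\<close> as \<open>(v - b) + (b - y a)\<close>
  with a node \<open>b\<close>: the first part removes a factor and a node, the second only a
  factor.\<close>

lemma lagrange_sum:
  fixes V :: "'a::field set" and y :: "'b \<Rightarrow> 'a"
  assumes "finite V" "finite A" "card A < card V"
  shows "(\<Sum>v\<in>V. (\<Prod>a\<in>A. v - y a) / (\<Prod>u\<in>V - {v}. v - u))
    = (if Suc (card A) = card V then 1 else 0)"
  using assms(2,1,3)
proof (induction A arbitrary: V rule: finite_induct)
  case empty
  then have "V \<noteq> {}" by auto
  then show ?case using lagrange_sum_const[of V] empty by auto
next
  case (insert a A)
  then obtain b where b: "b \<in> V" by fastforce
  have del: "(\<Sum>v\<in>V. (v - b) * (\<Prod>a\<in>A. v - y a) / (\<Prod>u\<in>V - {v}. v - u))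
      = (\<Sum>v\<in>V - {b}. (\<Prod>a\<in>A. v - y a) / (\<Prod>u\<in>V - {b} - {v}. v - u))"
  proof -
    have "(v - b) * (\<Prod>a\<in>A. v - y a) / (\<Prod>u\<in>V - {v}. v - u)
        = (\<Prod>a\<in>A. v - y a) / (\<Prod>u\<in>V - {b} - {v}. v - u)" if "v \<in> V - {b}" for v
    proof -
      have "V - {v} = insert b (V - {b} - {v})" using that b by auto
      then show ?thesis using that insert.prems by (simp add: prod.insert_remove)
    qed
    then show ?thesis using b insert.prems by (simp add: sum.remove[of V b])
  qed
  have "(\<Sum>v\<in>V. (\<Prod>a\<in>insert a A. v - y a) / (\<Prod>u\<in>V - {v}. v - u))
      = (\<Sum>v\<in>V. (v - b) * (\<Prod>a\<in>A. v - y a) / (\<Prod>u\<in>V - {v}. v - u))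
        + (b - y a) * (\<Sum>v\<in>V. (\<Prod>a\<in>A. v - y a) / (\<Prod>u\<in>V - {v}. v - u))"
    using insert.hyps
    by (simp add: sum_distrib_left algebra_simps flip: sum.distrib add_divide_distrib)
  also have "\<dots> = (if Suc (card (insert a A)) = card V then 1 else 0)"
    unfolding del using insert.IH[of "V - {b}"] insert.IH[of V] insert.prems insert.hyps b by auto
  finally show ?case .
qed

text \<open>The product of \<open>\<bar>x i - x j\<bar>\<close> over ordered pairs is the squared Vandermonde determinant.\<close>

definition pair_weight :: "('i \<Rightarrow> real) \<Rightarrow> ('i \<Rightarrow> real) \<Rightarrow> 'i set \<Rightarrow> real" where
  "pair_weight x w R = (\<Prod>i\<in>R. w i * (\<Prod>j\<in>R - {i}. \<bar>x i - x j\<bar>))"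

text \<open>By Cauchy-Binet this is the \<open>k\<close> by \<open>k\<close> Hankel determinant of
  the moments of the discrete measure with weights \<open>w\<close> at the nodes
  \<open>x\<close>.\<close>

definition tau :: "'i set \<Rightarrow> ('i \<Rightarrow> real) \<Rightarrow> ('i \<Rightarrow> real) \<Rightarrow> nat \<Rightarrow> real" where
  "tau I x w k = (\<Sum>R\<in>nsets I k. pair_weight x w R)"

text \<open>The new point forms two ordered pairs with each \<open>r\<close> in \<open>R\<close>,
  hence the square; it also makes the absolute values harmless.\<close>

lemma pair_weight_insert:
  assumes "finite R" "s \<notin> R"
  shows "pair_weight x w (insert s R) = pair_weight x w R * w s * (\<Prod>r\<in>R. x s - x r)\<^sup>2"
proof -
  have "(\<Prod>j\<in>insert s R - {i}. \<bar>x i - x j\<bar>) = \<bar>x s - x i\<bar> * (\<Prod>j\<in>R - {i}. \<bar>x i - x j\<bar>)"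
    if "i \<in> R" for i
  proof -
    have "insert s R - {i} = insert s (R - {i})" using that assms by auto
    then show ?thesis using assms that by (simp add: abs_minus_commute)
  qed
  then have "(\<Prod>i\<in>R. w i * (\<Prod>j\<in>insert s R - {i}. \<bar>x i - x j\<bar>))
      = (\<Prod>i\<in>R. \<bar>x s - x i\<bar>) * pair_weight x w R"
    by (simp add: pair_weight_def mult_ac flip: prod.distrib)
  moreover have "(\<Prod>r\<in>R. x s - x r)\<^sup>2 = (\<Prod>i\<in>R. \<bar>x s - x i\<bar>) * (\<Prod>i\<in>R. \<bar>x s - x i\<bar>)"
    by (simp add: power2_eq_square abs_prod[symmetric] abs_mult_self_eq)
  moreover have "insert s R - {s} = R" using assms by auto
  ultimately show ?thesis using assms by (simp add: pair_weight_def[of x w "insert s R"] mult_ac)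
qed

lemma pair_weight_mult:
  "pair_weight x (\<lambda>i. w i * h i) R = pair_weight x w R * (\<Prod>i\<in>R. h i)"
  by (simp add: pair_weight_def mult_ac flip: prod.distrib)

lemma tau_scale: "tau I x (\<lambda>i. c * w i) k = c ^ k * tau I x w k"
proof -
  have "pair_weight x (\<lambda>i. c * w i) R = c ^ k * pair_weight x w R" if "R \<in> nsets I k" for R
    using pair_weight_mult[of x w "\<lambda>_. c" R] that by (simp add: nsets_def mult.commute)
  then show ?thesis by (simp add: tau_def sum_distrib_left)
qed

section \<open>Double sums over subsets and the exchange of a point\<close>

text \<open>A set with a marked element is the same as a smaller set with a marked point outside
  it.\<close>

lemma sum_nsets_Suc:
  fixes g :: "'i set \<Rightarrow> 'i \<Rightarrow> 'a::comm_monoid_add"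
  assumes "finite I"
  shows "(\<Sum>S\<in>nsets I (Suc l). \<Sum>s\<in>S. g (S - {s}) s) = (\<Sum>U\<in>nsets I l. \<Sum>s\<in>I - U. g U s)"
proof -
  have fin: "finite S" if "S \<in> nsets I k" for S k using that by (simp add: nsets_def)
  have finn: "finite (nsets I k)" for k using assms by (simp add: finite_imp_finite_nsets)
  have "(\<Sum>S\<in>nsets I (Suc l). \<Sum>s\<in>S. g (S - {s}) s)
      = (\<Sum>(S, s)\<in>(SIGMA S:nsets I (Suc l). S). g (S - {s}) s)"
    using fin finn by (subst sum.Sigma) auto
  also have "\<dots> = (\<Sum>(U, s)\<in>(SIGMA U:nsets I l. I - U). g U s)"
    by (rule sum.reindex_bij_witness[of _ "\<lambda>(U, s). (insert s U, s)" "\<lambda>(S, s). (S - {s}, s)"])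
       (auto simp: nsets_def insert_absorb)
  also have "\<dots> = (\<Sum>U\<in>nsets I l. \<Sum>s\<in>I - U. g U s)"
    using finn assms by (subst sum.Sigma) auto
  finally show ?thesis .
qed

lemma prod_neg_diff:
  fixes z :: real
  assumes "finite R"
  shows "(\<Prod>r\<in>R. z - x r) = (-1) ^ card R * (\<Prod>r\<in>R. x r - z)"
proof -
  have "(\<Prod>r\<in>R. z - x r) = (\<Prod>r\<in>R. (-1) * (x r - z))" by simp
  then show ?thesis by (simp only: prod.distrib prod_constant)
qed

text \<open>Interpolation on the nodes \<open>Z\<close> together with \<open>x s\<close> for
  \<open>s\<close> in \<open>S\<close>. Disjointness and injectivity let each denominator factor
  into a part from \<open>S\<close> and a part from \<open>Z\<close>.\<close>

lemma lagrange_sum_image: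
  fixes x :: "'i \<Rightarrow> real"
  assumes "finite S" "inj_on x S" "finite Z" "Z \<inter> x ` S = {}" "finite A" "card A < card S + card Z"
  shows "(\<Sum>z\<in>Z. (\<Prod>a\<in>A. z - y a) / ((\<Prod>s\<in>S. z - x s) * (\<Prod>z'\<in>Z - {z}. z - z')))
       + (\<Sum>s\<in>S. (\<Prod>a\<in>A. x s - y a) / ((\<Prod>r\<in>S - {s}. x s - x r) * (\<Prod>z\<in>Z. x s - z)))
       = (if Suc (card A) = card S + card Z then 1 else 0)"
proof -
  have *: "card (Z \<union> x ` S) = card S + card Z"
    using assms by (simp add: card_Un_disjoint card_image)
  have 1: "(\<Prod>u\<in>Z \<union> x ` S - {z}. z - u) = (\<Prod>s\<in>S. z - x s) * (\<Prod>z'\<in>Z - {z}. z - z')"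
    if "z \<in> Z" for z
  proof -
    have "Z \<union> x ` S - {z} = x ` S \<union> (Z - {z})" "x ` S \<inter> (Z - {z}) = {}" using that assms by auto
    then show ?thesis using assms by (simp add: prod.union_disjoint prod.reindex)
  qed
  have 2: "(\<Prod>u\<in>Z \<union> x ` S - {x s}. x s - u) = (\<Prod>r\<in>S - {s}. x s - x r) * (\<Prod>z\<in>Z. x s - z)"
    if "s \<in> S" for s
  proof -
    have "Z \<union> x ` S - {x s} = x ` (S - {s}) \<union> Z" "x ` (S - {s}) \<inter> Z = {}"
      using that assms(2,4) by (auto simp: inj_on_def)
    moreover have "inj_on x (S - {s})" using assms(2) by (rule inj_on_subset) auto
    ultimately show ?thesis using assms by (simp add: prod.union_disjoint prod.reindex)
  qed
  have "(\<Sum>v\<in>Z \<union> x ` S. (\<Prod>a\<in>A. v - y a) / (\<Prod>u\<in>Z \<union> x ` S - {v}. v - u))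
      = (\<Sum>z\<in>Z. (\<Prod>a\<in>A. z - y a) / ((\<Prod>s\<in>S. z - x s) * (\<Prod>z'\<in>Z - {z}. z - z')))
       + (\<Sum>s\<in>S. (\<Prod>a\<in>A. x s - y a) / ((\<Prod>r\<in>S - {s}. x s - x r) * (\<Prod>z\<in>Z. x s - z)))"
    using assms by (simp add: sum.union_disjoint sum.reindex 1 2)
  then show ?thesis using lagrange_sum[of "Z \<union> x ` S" A y] assms * by simp
qed

lemma pair_weight_remove:
  assumes "finite R" "s \<in> R"
  shows "pair_weight x w R = pair_weight x w (R - {s}) * w s * (\<Prod>r\<in>R - {s}. x s - x r)\<^sup>2"
  using pair_weight_insert[of "R - {s}" s x w] assms by (simp add: insert_absorb)

text \<open>Both sides equal the sum over \<open>R\<close> (of size \<open>k\<close>), \<open>U\<close> (of size \<open>l\<close>) and a point \<open>s\<close> outside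
  both, with \<open>S = U \<union> {s}\<close> on the left and \<open>V = R \<union> {s}\<close> on the right.\<close>

lemma sum_exchange:
  fixes x w h f :: "'i \<Rightarrow> real"
  assumes "finite I" "inj_on x I"
  shows "(\<Sum>R\<in>nsets I k. \<Sum>S\<in>nsets I (Suc l). pair_weight x w R * pair_weight x (\<lambda>i. w i * h i) S
            * (\<Sum>s\<in>S. f s * (\<Prod>r\<in>R. x s - x r) / (\<Prod>r\<in>S - {s}. x s - x r)))
       = (\<Sum>V\<in>nsets I (Suc k). \<Sum>U\<in>nsets I l. pair_weight x w V * pair_weight x (\<lambda>i. w i * h i) U
            * (\<Sum>s\<in>V. f s * h s * (\<Prod>r\<in>U. x s - x r) / (\<Prod>r\<in>V - {s}. x s - x r)))"
proof -
  let ?A = "pair_weight x w" and ?B = "pair_weight x (\<lambda>i. w i * h i)"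
  let ?F = "\<lambda>R s. \<Prod>r\<in>R. x s - x r"
  \<comment> \<open>The common summand: removing \<open>s\<close> from a set releases a squared
    product, one factor of which cancels the denominator, so \<open>R\<close> and \<open>U\<close>
    end up in symmetric roles.\<close>
  define K where "K R U s = ?A R * ?B U * w s * h s * f s * ?F R s * ?F U s" for R U s
  have nz: "?F (S - {s}) s \<noteq> 0" if "S \<in> nsets I j" "s \<in> S" for S s j
    using that assms by (auto simp: nsets_def inj_on_def)
  have z: "?F S s = 0" if "S \<in> nsets I j" "s \<in> S" for S s j
    using that by (auto simp: nsets_def)
  have restrict: "(\<Sum>s\<in>I - S. g s * ?F S s) = (\<Sum>s\<in>I. g s * ?F S s)" if "S \<in> nsets I j" for S g j
    using z[OF that] assms that by (intro sum.mono_neutral_left) (auto simp: nsets_def)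
  have "(\<Sum>R\<in>nsets I k. \<Sum>S\<in>nsets I (Suc l). ?A R * ?B S * (\<Sum>s\<in>S. f s * ?F R s / ?F (S - {s}) s))
      = (\<Sum>R\<in>nsets I k. \<Sum>S\<in>nsets I (Suc l). \<Sum>s\<in>S. K R (S - {s}) s)"
  proof (intro sum.cong refl)
    fix R S assume S: "S \<in> nsets I (Suc l)"
    have "?A R * ?B S * (f s * ?F R s / ?F (S - {s}) s) = K R (S - {s}) s" if "s \<in> S" for s
    proof -
      have "finite S" using S by (simp add: nsets_def)
      then have "?B S = ?B (S - {s}) * (w s * h s) * (?F (S - {s}) s)\<^sup>2"
        using pair_weight_remove[OF _ that] by blast
      then show ?thesis using nz[OF S that] by (simp add: K_def power2_eq_square)
    qed
    then show "?A R * ?B S * (\<Sum>s\<in>S. f s * ?F R s / ?F (S - {s}) s) = (\<Sum>s\<in>S. K R (S - {s}) s)"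
      by (simp add: sum_distrib_left)
  qed
  also have "\<dots> = (\<Sum>R\<in>nsets I k. \<Sum>U\<in>nsets I l. \<Sum>s\<in>I - U. K R U s)"
    by (simp add: sum_nsets_Suc[OF assms(1), of "K _"])
  also have "\<dots> = (\<Sum>R\<in>nsets I k. \<Sum>U\<in>nsets I l. \<Sum>s\<in>I. K R U s)"
    unfolding K_def by (intro sum.cong refl restrict)
  also have "\<dots> = (\<Sum>U\<in>nsets I l. \<Sum>R\<in>nsets I k. \<Sum>s\<in>I. K R U s)" by (rule sum.swap)
  also have "\<dots> = (\<Sum>U\<in>nsets I l. \<Sum>R\<in>nsets I k. \<Sum>s\<in>I - R. K R U s)"
  proof (rule sum.cong[OF refl], rule sum.cong[OF refl])
    fix U R assume "R \<in> nsets I k"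
    then show "(\<Sum>s\<in>I. K R U s) = (\<Sum>s\<in>I - R. K R U s)"
      using restrict[of R k "\<lambda>s. ?A R * ?B U * w s * h s * f s * ?F U s"]
      by (simp add: K_def mult_ac)
  qed
  also have "\<dots> = (\<Sum>U\<in>nsets I l. \<Sum>V\<in>nsets I (Suc k). \<Sum>s\<in>V. K (V - {s}) U s)"
    by (simp add: sum_nsets_Suc[OF assms(1), of "\<lambda>R s. K R _ s"])
  also have "\<dots> = (\<Sum>V\<in>nsets I (Suc k). \<Sum>U\<in>nsets I l. \<Sum>s\<in>V. K (V - {s}) U s)" by (rule sum.swap)
  also have "\<dots> = (\<Sum>V\<in>nsets I (Suc k). \<Sum>U\<in>nsets I l. ?A V * ?B U
            * (\<Sum>s\<in>V. f s * h s * ?F U s / ?F (V - {s}) s))"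
  proof (intro sum.cong refl)
    fix V U assume V: "V \<in> nsets I (Suc k)"
    have "?A V * ?B U * (f s * h s * ?F U s / ?F (V - {s}) s) = K (V - {s}) U s" if "s \<in> V" for s
    proof -
      have "finite V" using V by (simp add: nsets_def)
      then have "?A V = ?A (V - {s}) * w s * (?F (V - {s}) s)\<^sup>2"
        using pair_weight_remove[OF _ that] by blast
      then show ?thesis using nz[OF V that] by (simp add: K_def power2_eq_square)
    qed
    then show "(\<Sum>s\<in>V. K (V - {s}) U s) = ?A V * ?B U * (\<Sum>s\<in>V. f s * h s * ?F U s / ?F (V - {s}) s)"
      by (simp add: sum_distrib_left)
  qed
  finally show ?thesis .
qed

lemma tau_mult_tau:
  "tau I x w k * tau I x w' l = (\<Sum>R\<in>nsets I k. \<Sum>S\<in>nsets I l. pair_weight x w R * pair_weight x w' S)"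
  by (simp add: tau_def sum_product)

text \<open>For fixed \<open>R\<close>, \<open>S\<close> the polynomial with zeros
  \<open>x r\<close> is interpolated on \<open>Z\<close> and the nodes of \<open>S\<close>. At
  \<open>z\<close> in \<open>Z\<close> its value is absorbed into the weight of \<open>R\<close>,
  and the denominator cancels the factor of \<open>h\<close> at \<open>z\<close> in the weight of
  \<open>S\<close>. The part over \<open>S\<close> becomes, after moving a point to
  \<open>R\<close>, another interpolation sum, of degree \<open>l - 1 + card G\<close> on
  \<open>k + 1\<close> nodes. The bounds on \<open>k\<close> and \<open>l\<close> keep both degrees
  below the number of nodes; the two conditionals record when the top degree is reached.\<close>

lemma tau_bilinear:
  fixes x w :: "'i \<Rightarrow> real"
  assumes I: "finite I" "inj_on x I" and Z: "finite Z" "Z \<inter> x ` I = {}" and G: "finite G"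
    and kl: "k < l + card Z" "l + card G \<le> Suc k"
  defines "h \<equiv> \<lambda>i. (\<Prod>z\<in>Z. x i - z) * (\<Prod>a\<in>G. x i - a)"
  shows "(if Suc k = l + card Z then tau I x w k * tau I x (\<lambda>i. w i * h i) l else 0)
    = (-1) ^ (k + l) * (\<Sum>z\<in>Z. tau I x (\<lambda>i. w i * (x i - z)) k
         * tau I x (\<lambda>i. w i * ((\<Prod>z'\<in>Z - {z}. x i - z') * (\<Prod>a\<in>G. x i - a))) l
         / (\<Prod>z'\<in>Z - {z}. z - z'))
      + (if l + card G = Suc k \<and> l \<noteq> 0 then tau I x w (Suc k) * tau I x (\<lambda>i. w i * h i) (l - 1) else 0)"
proof -
  let ?A = "pair_weight x w" and ?B = "pair_weight x (\<lambda>i. w i * h i)"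
  \<comment> \<open>Dividing by the factors from \<open>Z\<close> leaves only the polynomial over
    \<open>G\<close> once the exchanged point also brings in \<open>h\<close>.\<close>
  define f where "f s = 1 / (\<Prod>z\<in>Z. x s - z)" for s
  have fh: "f s * h s = (\<Prod>a\<in>G. x s - a)" if "s \<in> I" for s
  proof -
    have "(\<Prod>z\<in>Z. x s - z) \<noteq> 0" using Z that by (auto simp: prod_zero_iff)
    then show ?thesis by (simp add: f_def h_def)
  qed
  define c1 :: real where "c1 = (if Suc k = l + card Z then 1 else 0)"
  define c2 :: real where "c2 = (if l + card G = Suc k then 1 else 0)"
  have A: "?A R * ?B S * c1
     = (\<Sum>z\<in>Z. (-1) ^ (k + l) * (pair_weight x (\<lambda>i. w i * (x i - z)) R
         * pair_weight x (\<lambda>i. w i * ((\<Prod>z'\<in>Z - {z}. x i - z') * (\<Prod>a\<in>G. x i - a))) S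
         / (\<Prod>z'\<in>Z - {z}. z - z')))
      + ?A R * ?B S * (\<Sum>s\<in>S. f s * (\<Prod>r\<in>R. x s - x r) / (\<Prod>r\<in>S - {s}. x s - x r))"
    if R: "R \<in> nsets I k" and S: "S \<in> nsets I l" for R S
  proof -
    have R': "finite R" "card R = k" and S': "finite S" "card S = l" "S \<subseteq> I"
      using R S by (auto simp: nsets_def)
    have inj: "inj_on x S" using I(2) S'(3) by (rule inj_on_subset)
    have ZS: "Z \<inter> x ` S = {}" using Z S'(3) by auto
    have "c1 = (\<Sum>z\<in>Z. (\<Prod>r\<in>R. z - x r) / ((\<Prod>s\<in>S. z - x s) * (\<Prod>z'\<in>Z - {z}. z - z')))
       + (\<Sum>s\<in>S. f s * (\<Prod>r\<in>R. x s - x r) / (\<Prod>r\<in>S - {s}. x s - x r))"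
      using lagrange_sum_image[OF S'(1) inj Z(1) ZS R'(1), of x] R' S' kl
      by (simp add: c1_def f_def mult_ac)
    then have "?A R * ?B S * c1 = (\<Sum>z\<in>Z. ?A R * ?B S * ((\<Prod>r\<in>R. z - x r) / ((\<Prod>s\<in>S. z - x s) * (\<Prod>z'\<in>Z - {z}. z - z'))))
      + ?A R * ?B S * (\<Sum>s\<in>S. f s * (\<Prod>r\<in>R. x s - x r) / (\<Prod>r\<in>S - {s}. x s - x r))"
      by (simp add: distrib_left sum_distrib_left)
    also have "(\<Sum>z\<in>Z. ?A R * ?B S * ((\<Prod>r\<in>R. z - x r) / ((\<Prod>s\<in>S. z - x s) * (\<Prod>z'\<in>Z - {z}. z - z'))))
      = (\<Sum>z\<in>Z. (-1) ^ (k + l) * (pair_weight x (\<lambda>i. w i * (x i - z)) R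
         * pair_weight x (\<lambda>i. w i * ((\<Prod>z'\<in>Z - {z}. x i - z') * (\<Prod>a\<in>G. x i - a))) S
         / (\<Prod>z'\<in>Z - {z}. z - z')))"
    proof (intro sum.cong refl)
      fix z assume z: "z \<in> Z"
      have nz: "(\<Prod>s\<in>S. x s - z) \<noteq> 0" using ZS z S' by auto
      have "h i = (x i - z) * ((\<Prod>z'\<in>Z - {z}. x i - z') * (\<Prod>a\<in>G. x i - a))" for i
        using z Z(1) by (simp add: h_def prod.remove mult_ac)
      then have BS: "?B S = pair_weight x (\<lambda>i. w i * ((\<Prod>z'\<in>Z - {z}. x i - z') * (\<Prod>a\<in>G. x i - a))) S
           * (\<Prod>s\<in>S. x s - z)"
        by (simp only: pair_weight_mult prod.distrib mult_ac)
      \<comment> \<open>Reversing the differences gives \<open>(-1) ^ k\<close> from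
        \<open>R\<close> in the numerator and \<open>(-1) ^ l\<close> from \<open>S\<close> in the
        denominator.\<close>
      have sgn: "(-1) ^ k / (-1) ^ l = ((-1) ^ (k + l) :: real)"
        by (simp add: power_add minus_one_power_iff)
      have *: "a * (b * q) * (e1 * p / (e2 * q * d)) = e1 / e2 * (a * p * b / d)"
        if "q \<noteq> 0" for a b q e1 e2 p d :: real
        using that by simp
      show "?A R * ?B S * ((\<Prod>r\<in>R. z - x r) / ((\<Prod>s\<in>S. z - x s) * (\<Prod>z'\<in>Z - {z}. z - z')))
        = (-1) ^ (k + l) * (pair_weight x (\<lambda>i. w i * (x i - z)) R
         * pair_weight x (\<lambda>i. w i * ((\<Prod>z'\<in>Z - {z}. x i - z') * (\<Prod>a\<in>G. x i - a))) S
         / (\<Prod>z'\<in>Z - {z}. z - z'))"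
        unfolding BS prod_neg_diff[OF R'(1)] prod_neg_diff[OF S'(1)] R'(2) S'(2)
          pair_weight_mult[of x w "\<lambda>i. x i - z"]
        by (subst *[OF nz]) (simp only: sgn)
    qed
    finally show ?thesis .
  qed
  have B: "(\<Sum>s\<in>V. f s * h s * (\<Prod>r\<in>U. x s - x r) / (\<Prod>r\<in>V - {s}. x s - x r)) = c2"
    if V: "V \<in> nsets I (Suc k)" and U: "U \<in> nsets I l'" and l: "l = Suc l'" for V U l'
  proof -
    have V': "finite V" "card V = Suc k" "V \<subseteq> I" and U': "finite U" "card U = l'"
      using V U by (auto simp: nsets_def)
    have inj: "inj_on x V" using I(2) V'(3) by (rule inj_on_subset)
    \<comment> \<open>The disjoint sum \<open>U <+> G\<close> counts the zeros with multiplicity,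
      even if a node of \<open>U\<close> lies in \<open>G\<close>.\<close>
    have "(\<Sum>s\<in>V. f s * h s * (\<Prod>r\<in>U. x s - x r) / (\<Prod>r\<in>V - {s}. x s - x r))
       = (\<Sum>s\<in>V. (\<Prod>a\<in>U <+> G. x s - case_sum x id a) / (\<Prod>r\<in>V - {s}. x s - x r))"
    proof (intro sum.cong refl)
      fix s assume "s \<in> V"
      then have "s \<in> I" using V' by auto
      then show "f s * h s * (\<Prod>r\<in>U. x s - x r) / (\<Prod>r\<in>V - {s}. x s - x r)
         = (\<Prod>a\<in>U <+> G. x s - case_sum x id a) / (\<Prod>r\<in>V - {s}. x s - x r)"
        using fh[of s] U' G by (simp add: prod.Plus mult_ac)
    qed
    also have "\<dots> = c2"
      using lagrange_sum_image[OF V'(1) inj, of "{}" "U <+> G" "case_sum x id"] V' U' G kl l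
      by (simp add: c2_def card_Plus)
    finally show ?thesis .
  qed
  have C: "(\<Sum>R\<in>nsets I k. \<Sum>S\<in>nsets I l. ?A R * ?B S * (\<Sum>s\<in>S. f s * (\<Prod>r\<in>R. x s - x r) / (\<Prod>r\<in>S - {s}. x s - x r)))
     = (if l \<noteq> 0 then c2 * (tau I x w (Suc k) * tau I x (\<lambda>i. w i * h i) (l - 1)) else 0)"
  proof (cases l)
    \<comment> \<open>The empty set has no point to move, so this part is zero.\<close>
    case 0
    then have "S = {}" if "S \<in> nsets I l" for S using that by (auto simp: nsets_def)
    then show ?thesis using 0 by simp
  next
    case (Suc l')
    have "(\<Sum>R\<in>nsets I k. \<Sum>S\<in>nsets I l. ?A R * ?B S * (\<Sum>s\<in>S. f s * (\<Prod>r\<in>R. x s - x r) / (\<Prod>r\<in>S - {s}. x s - x r)))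
      = (\<Sum>V\<in>nsets I (Suc k). \<Sum>U\<in>nsets I l'. ?A V * ?B U * c2)"
      unfolding Suc sum_exchange[OF I] by (intro sum.cong refl arg_cong2[of _ _ _ _ "(*)"] B[OF _ _ Suc])
    then show ?thesis using Suc by (simp add: tau_mult_tau sum_distrib_left mult_ac)
  qed
  have "c1 * (tau I x w k * tau I x (\<lambda>i. w i * h i) l) = (\<Sum>R\<in>nsets I k. \<Sum>S\<in>nsets I l. ?A R * ?B S * c1)"
    by (simp add: tau_mult_tau sum_distrib_left mult_ac)
  also have "\<dots> = (\<Sum>R\<in>nsets I k. \<Sum>S\<in>nsets I l. (\<Sum>z\<in>Z. (-1) ^ (k + l) * (pair_weight x (\<lambda>i. w i * (x i - z)) R
         * pair_weight x (\<lambda>i. w i * ((\<Prod>z'\<in>Z - {z}. x i - z') * (\<Prod>a\<in>G. x i - a))) S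
         / (\<Prod>z'\<in>Z - {z}. z - z'))))
      + (\<Sum>R\<in>nsets I k. \<Sum>S\<in>nsets I l. ?A R * ?B S * (\<Sum>s\<in>S. f s * (\<Prod>r\<in>R. x s - x r) / (\<Prod>r\<in>S - {s}. x s - x r)))"
    by (simp add: A flip: sum.distrib)
  also have "(\<Sum>R\<in>nsets I k. \<Sum>S\<in>nsets I l. (\<Sum>z\<in>Z. (-1) ^ (k + l) * (pair_weight x (\<lambda>i. w i * (x i - z)) R
         * pair_weight x (\<lambda>i. w i * ((\<Prod>z'\<in>Z - {z}. x i - z') * (\<Prod>a\<in>G. x i - a))) S
         / (\<Prod>z'\<in>Z - {z}. z - z'))))
     = (-1) ^ (k + l) * (\<Sum>z\<in>Z. tau I x (\<lambda>i. w i * (x i - z)) k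
         * tau I x (\<lambda>i. w i * ((\<Prod>z'\<in>Z - {z}. x i - z') * (\<Prod>a\<in>G. x i - a))) l
         / (\<Prod>z'\<in>Z - {z}. z - z'))"
    by (simp only: sum.swap[of _ Z] tau_mult_tau sum_distrib_left sum_divide_distrib)
  finally show ?thesis
    unfolding C
    by (cases "Suc k = l + card Z"; cases "l + card G = Suc k"; cases "l = 0")
       (simp_all add: c1_def c2_def)
qed

section \<open>Bilinear identities\<close>

context
  fixes I :: "'i set" and x :: "'i \<Rightarrow> real"
  assumes I: "finite I" "inj_on x I"
begin

text \<open>With three zeros in \<open>Z\<close> and empty \<open>G\<close>, the range of
  \<open>k\<close> excludes both top-degree cases, so only the sum over \<open>Z\<close>
  survives.\<close>

lemma tau_plucker:
  assumes "a \<noteq> b" "b \<noteq> c" "c \<noteq> a" "{a, b, c} \<inter> x ` I = {}" "l \<le> k" "k \<le> Suc l"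
  shows "(b - c) * (tau I x (\<lambda>i. w i * (x i - a)) k * tau I x (\<lambda>i. w i * ((x i - b) * (x i - c))) l)
    + (c - a) * (tau I x (\<lambda>i. w i * (x i - b)) k * tau I x (\<lambda>i. w i * ((x i - a) * (x i - c))) l)
    + (a - b) * (tau I x (\<lambda>i. w i * (x i - c)) k * tau I x (\<lambda>i. w i * ((x i - a) * (x i - b))) l) = 0"
proof -
  have d: "{a, b, c} - {a} = {b, c}" "{a, b, c} - {b} = {a, c}" "{a, b, c} - {c} = {a, b}"
    using assms by auto
  have *: "A / ((a - b) * (a - c)) + (B / ((b - a) * (b - c)) + C / ((c - a) * (c - b))) = 0
    \<Longrightarrow> (b - c) * A + (c - a) * B + (a - b) * C = 0" for A B C
    using assms(1-3) by (simp add: divide_simps split: if_splits) algebra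
  show ?thesis
    by (rule *) (use tau_bilinear[OF I, of "{a, b, c}" "{}" k l w] assms in
      \<open>simp add: d\<close>)
qed

text \<open>Here \<open>k = l + 1\<close> with two zeros in \<open>Z\<close> and one in
  \<open>G\<close>: the first interpolation reaches its top degree, the second does not.\<close>

lemma tau_plucker_pair:
  assumes "a \<noteq> b" "{a, b} \<inter> x ` I = {}"
  shows "(a - b) * (tau I x w (Suc l) * tau I x (\<lambda>i. w i * ((x i - a) * (x i - b) * (x i - c))) l)
    = tau I x (\<lambda>i. w i * (x i - b)) (Suc l) * tau I x (\<lambda>i. w i * ((x i - a) * (x i - c))) l
    - tau I x (\<lambda>i. w i * (x i - a)) (Suc l) * tau I x (\<lambda>i. w i * ((x i - b) * (x i - c))) l"
proof -
  have d: "{a, b} - {a} = {b}" "{a, b} - {b} = {a}" using assms by auto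
  have *: "X = - (A / (a - b) + B / (b - a)) \<Longrightarrow> (a - b) * X = B - A" for A B X
    using assms(1) by (simp add: divide_simps split: if_splits) algebra
  show ?thesis
    by (rule *) (use tau_bilinear[OF I, of "{a, b}" "{c}" "Suc l" l w] assms in \<open>simp add: d\<close>)
qed

text \<open>With one zero in each of \<open>Z\<close> and \<open>G\<close> and \<open>k = l\<close>,
  both interpolations reach their top degree. Only \<open>a\<close> serves as an extra node, so
  \<open>b\<close> is free.\<close>

lemma tau_jacobi:
  assumes "a \<notin> x ` I"
  shows "tau I x w (Suc n) * tau I x (\<lambda>i. w i * ((x i - a) * (x i - b))) (Suc n)
    = tau I x (\<lambda>i. w i * (x i - a)) (Suc n) * tau I x (\<lambda>i. w i * (x i - b)) (Suc n)
    + tau I x w (Suc (Suc n)) * tau I x (\<lambda>i. w i * ((x i - a) * (x i - b))) n"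
  using tau_bilinear[OF I, of "{a}" "{b}" "Suc n" "Suc n" w] assms by simp

end

section \<open>Specialization to nodes \<open>1 / (p + \<delta>)\<close>\<close>

lemma tau_cong: "(\<And>i. i \<in> I \<Longrightarrow> w i = w' i) \<Longrightarrow> tau I x w k = tau I x w' k"
  unfolding tau_def pair_weight_def by (intro sum.cong prod.cong refl) (auto simp: nsets_def)

lemma tau_scale_cong:
  assumes "\<And>i. i \<in> I \<Longrightarrow> w' i = c * w i"
  shows "tau I x w' k = c ^ k * tau I x w k"
  using tau_cong[of I w' "\<lambda>i. c * w i", OF assms] tau_scale[of I x c w k] by simp

context
  fixes I :: "'i set" and p w :: "'i \<Rightarrow> real" and \<delta> m :: real and c :: "'i \<Rightarrow> real"
    and t :: "('i \<Rightarrow> real) \<Rightarrow> nat \<Rightarrow> real"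
  assumes fin: "finite I" and inj: "inj_on p I" and pos: "\<And>i. i \<in> I \<Longrightarrow> 0 < p i"
    and m: "0 < m" "m < \<delta>"
  defines "c \<equiv> \<lambda>i. p i + \<delta>"
  defines "t \<equiv> \<lambda>h. tau I (\<lambda>i. 1 / c i) (\<lambda>i. w i * h i)"
begin

text \<open>In \<open>x = 1 / c\<close> the factors \<open>1 / c\<close>, \<open>p / c\<close>,
  \<open>(p + m) / c\<close> are linear with zeros \<open>0\<close>, \<open>1 / \<delta>\<close>,
  \<open>1 / (\<delta> - m)\<close>. The first two identities are three-term relations for sizes
  \<open>(n, n)\<close> and \<open>(n + 1, n)\<close>, the next two come from
  \<open>tau_jacobi\<close>, the last from \<open>tau_plucker_pair\<close>. All terms are arranged
  to have positive coefficients, as the passage to growth rates requires.\<close>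

lemma discrete_identities:
  shows "\<delta> * (t (\<lambda>i. (p i + m) / c i / c i) n * t (\<lambda>i. p i / c i) n)
      = (\<delta> - m) * (t (\<lambda>i. (p i + m) / c i) n * t (\<lambda>i. p i / c i / c i) n)
        + m * (t (\<lambda>i. 1 / c i) n * t (\<lambda>i. p i * (p i + m) / c i / c i) n)"
    and "t (\<lambda>i. (p i + m) / c i) (Suc n) * t (\<lambda>i. p i / c i / c i) n
      = t (\<lambda>i. (p i + m) / c i / c i) n * t (\<lambda>i. p i / c i) (Suc n)
        + m * (t (\<lambda>i. p i * (p i + m) / c i / c i) n * t (\<lambda>i. 1 / c i) (Suc n))"
    and "t (\<lambda>i. 1 / c i) (Suc n) * t (\<lambda>i. p i / c i) (Suc n)
      = t (\<lambda>_. 1) (Suc n) * t (\<lambda>i. p i / c i / c i) (Suc n)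
        + \<delta> * (t (\<lambda>_. 1) (Suc (Suc n)) * t (\<lambda>i. p i / c i / c i) n)"
    and "t (\<lambda>i. p i * (p i + m) / c i / c i) (Suc n) * t (\<lambda>_. 1) (Suc n)
      = t (\<lambda>i. p i / c i) (Suc n) * t (\<lambda>i. (p i + m) / c i) (Suc n)
        + \<delta> * (\<delta> - m) * (t (\<lambda>_. 1) (Suc (Suc n)) * t (\<lambda>i. p i * (p i + m) / c i / c i) n)"
    and "t (\<lambda>_. 1) (Suc n) * t (\<lambda>i. p i * (p i + m) / c i / c i / c i) n
      = t (\<lambda>i. (p i + m) / c i) (Suc n) * t (\<lambda>i. p i / c i / c i) n
        + (\<delta> - m) * (t (\<lambda>i. p i * (p i + m) / c i / c i) n * t (\<lambda>i. 1 / c i) (Suc n))"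
proof -
  define x where "x i = 1 / c i" for i
  define \<epsilon> where "\<epsilon> = \<delta> - m"
  have \<epsilon>: "\<epsilon> > 0" "\<epsilon> < \<delta>" "\<delta> > 0" using m by (auto simp: \<epsilon>_def)
  have cpos: "c i > 0" "\<delta> < c i" if "i \<in> I" for i using pos[OF that] m by (auto simp: c_def)
  define s where "s h = tau I x (\<lambda>i. w i * h i)" for h
  have injx: "inj_on x I" using inj by (auto simp: inj_on_def x_def c_def)
  let ?d = "1 / \<delta>" and ?e = "1 / \<epsilon>"
  \<comment> \<open>All nodes lie strictly between \<open>0\<close> and \<open>1 / \<delta>\<close>,
    and \<open>1 / \<delta> < 1 / \<epsilon>\<close>.\<close>
  have nm: "{0, ?d, ?e} \<inter> x ` I = {}" "{0, ?e} \<inter> x ` I = {}" "0 \<notin> x ` I" "?d \<notin> x ` I"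
    using cpos \<epsilon> by (auto simp: x_def) (smt (verit, best))+
  have ne: "0 \<noteq> ?d" "?d \<noteq> ?e" "?e \<noteq> 0" "0 \<noteq> ?e" using \<epsilon> by auto
  have sc: "t h k = C ^ k * s h' k" if "\<And>i. i \<in> I \<Longrightarrow> h i = C * h' i" for h h' C k
    unfolding t_def s_def x_def by (rule tau_scale_cong) (use that in auto)
  have Y: "p i / c i = - \<delta> * (x i - ?d)" and Z: "(p i + m) / c i = - \<epsilon> * (x i - ?e)" if "i \<in> I" for i
  proof -
    have "p i / c i = 1 - \<delta> * x i" "(p i + m) / c i = 1 - \<epsilon> * x i"
      using cpos(1)[OF that] by (simp_all add: x_def c_def \<epsilon>_def divide_simps)
    then show "p i / c i = - \<delta> * (x i - ?d)" "(p i + m) / c i = - \<epsilon> * (x i - ?e)"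
      using \<epsilon> by (simp_all add: right_diff_distrib)
  qed
  have tr: "t (\<lambda>_. 1) k = s (\<lambda>_. 1) k"
    "t (\<lambda>i. 1 / c i) k = s (\<lambda>i. x i - 0) k"
    "t (\<lambda>i. p i / c i) k = (- \<delta>) ^ k * s (\<lambda>i. x i - ?d) k"
    "t (\<lambda>i. (p i + m) / c i) k = (- \<epsilon>) ^ k * s (\<lambda>i. x i - ?e) k"
    "t (\<lambda>i. p i / c i / c i) k = (- \<delta>) ^ k * s (\<lambda>i. (x i - 0) * (x i - ?d)) k"
    "t (\<lambda>i. (p i + m) / c i / c i) k = (- \<epsilon>) ^ k * s (\<lambda>i. (x i - 0) * (x i - ?e)) k"
    "t (\<lambda>i. p i * (p i + m) / c i / c i) k = (\<delta> * \<epsilon>) ^ k * s (\<lambda>i. (x i - ?d) * (x i - ?e)) k"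
    "t (\<lambda>i. p i * (p i + m) / c i / c i / c i) k
      = (\<delta> * \<epsilon>) ^ k * s (\<lambda>i. (x i - 0) * (x i - ?e) * (x i - ?d)) k" for k
  proof -
    have YZ: "p i * (p i + m) / c i / c i = (\<delta> * \<epsilon>) * ((x i - ?d) * (x i - ?e))" if "i \<in> I" for i
    proof -
      have "p i * (p i + m) / c i / c i = (p i / c i) * ((p i + m) / c i)" by simp
      then show ?thesis unfolding Y[OF that] Z[OF that] by simp
    qed
    have c: "y / c i = y * (x i - 0)" for y i by (simp add: x_def)
    show "t (\<lambda>_. 1) k = s (\<lambda>_. 1) k" using sc[of "\<lambda>_. 1" 1 "\<lambda>_. 1"] by simp
    show "t (\<lambda>i. 1 / c i) k = s (\<lambda>i. x i - 0) k"
      using sc[of "\<lambda>i. 1 / c i" 1 "\<lambda>i. x i - 0"] by (simp add: x_def)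
    show "t (\<lambda>i. p i / c i) k = (- \<delta>) ^ k * s (\<lambda>i. x i - ?d) k" by (rule sc) (rule Y)
    show "t (\<lambda>i. (p i + m) / c i) k = (- \<epsilon>) ^ k * s (\<lambda>i. x i - ?e) k" by (rule sc) (rule Z)
    show "t (\<lambda>i. p i / c i / c i) k = (- \<delta>) ^ k * s (\<lambda>i. (x i - 0) * (x i - ?d)) k"
      by (rule sc) (subst c, simp only: Y mult_ac)
    show "t (\<lambda>i. (p i + m) / c i / c i) k = (- \<epsilon>) ^ k * s (\<lambda>i. (x i - 0) * (x i - ?e)) k"
      by (rule sc) (subst c, simp only: Z mult_ac)
    show "t (\<lambda>i. p i * (p i + m) / c i / c i) k = (\<delta> * \<epsilon>) ^ k * s (\<lambda>i. (x i - ?d) * (x i - ?e)) k"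
      by (rule sc) (rule YZ)
    show "t (\<lambda>i. p i * (p i + m) / c i / c i / c i) k
      = (\<delta> * \<epsilon>) ^ k * s (\<lambda>i. (x i - 0) * (x i - ?e) * (x i - ?d)) k"
      by (rule sc) (subst c, simp only: YZ mult_ac)
  qed
  have m_eq: "m = \<delta> - \<epsilon>" by (simp add: \<epsilon>_def)
  have pw: "(- \<delta>) ^ k * (- \<epsilon>) ^ k = (\<delta> * \<epsilon>) ^ k" for k by (simp flip: power_mult_distrib)
  have plucker: "(1 / \<delta> - 1 / \<epsilon>) * (s (\<lambda>i. x i - 0) k * s (\<lambda>i. (x i - ?d) * (x i - ?e)) n)
    + ?e * (s (\<lambda>i. x i - ?d) k * s (\<lambda>i. (x i - 0) * (x i - ?e)) n)
    - ?d * (s (\<lambda>i. x i - ?e) k * s (\<lambda>i. (x i - 0) * (x i - ?d)) n) = 0" if "n \<le> k" "k \<le> Suc n" for k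
    using tau_plucker[OF fin injx ne(1,2,3) nm(1) that, of w] unfolding s_def by simp
  \<comment> \<open>Multiplication by \<open>\<delta> * \<epsilon>\<close> clears the fractions;
    \<open>\<epsilon> - \<delta> = - m\<close> gives the first coefficient.\<close>
  have plucker_mult: "- m * (s (\<lambda>i. x i - 0) k * s (\<lambda>i. (x i - ?d) * (x i - ?e)) n)
    + \<delta> * (s (\<lambda>i. x i - ?d) k * s (\<lambda>i. (x i - 0) * (x i - ?e)) n)
    - \<epsilon> * (s (\<lambda>i. x i - ?e) k * s (\<lambda>i. (x i - 0) * (x i - ?d)) n) = 0" if "n \<le> k" "k \<le> Suc n" for k
  proof -
    have *: "(1 / \<delta> - 1 / \<epsilon>) * A + ?e * B - ?d * C = 0 \<Longrightarrow> - m * A + \<delta> * B - \<epsilon> * C = 0"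
      (is "_ \<Longrightarrow> ?g") for A B C
    proof -
      have "- m * A + \<delta> * B - \<epsilon> * C = \<delta> * \<epsilon> * ((1 / \<delta> - 1 / \<epsilon>) * A + ?e * B - ?d * C)"
        using \<epsilon> unfolding m_eq by (simp add: field_simps)
      then show "(1 / \<delta> - 1 / \<epsilon>) * A + ?e * B - ?d * C = 0 \<Longrightarrow> ?g" by simp
    qed
    show ?thesis by (rule *[OF plucker[OF that]])
  qed
  have jac: "s (\<lambda>_. 1) (Suc n) * s (\<lambda>i. (x i - a) * (x i - b)) (Suc n)
    = s (\<lambda>i. x i - a) (Suc n) * s (\<lambda>i. x i - b) (Suc n)
      + s (\<lambda>_. 1) (Suc (Suc n)) * s (\<lambda>i. (x i - a) * (x i - b)) n" if "a \<notin> x ` I" for a b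
    using tau_jacobi[OF fin injx that, of w n b] unfolding s_def by simp
  have pl': "(0 - ?e) * (s (\<lambda>_. 1) (Suc n) * s (\<lambda>i. (x i - 0) * (x i - ?e) * (x i - ?d)) n)
    = s (\<lambda>i. x i - ?e) (Suc n) * s (\<lambda>i. (x i - 0) * (x i - ?d)) n
    - s (\<lambda>i. x i - 0) (Suc n) * s (\<lambda>i. (x i - ?e) * (x i - ?d)) n"
    using tau_plucker_pair[OF fin injx ne(4) nm(2), of w n ?d] unfolding s_def by simp

  show "\<delta> * (t (\<lambda>i. (p i + m) / c i / c i) n * t (\<lambda>i. p i / c i) n)
      = (\<delta> - m) * (t (\<lambda>i. (p i + m) / c i) n * t (\<lambda>i. p i / c i / c i) n)
        + m * (t (\<lambda>i. 1 / c i) n * t (\<lambda>i. p i * (p i + m) / c i / c i) n)"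
  proof -
    have "\<delta> * (e * A * (d * B)) = \<epsilon> * (e * C * (d * D)) + m * (E * (d * e * F))"
      if "- m * (E * F) + \<delta> * (B * A) - \<epsilon> * (C * D) = 0" for A B C D E F d e
      using that by algebra
    from this[OF plucker_mult] show ?thesis unfolding tr pw[symmetric] \<epsilon>_def[symmetric] by simp
  qed
  show "t (\<lambda>i. (p i + m) / c i) (Suc n) * t (\<lambda>i. p i / c i / c i) n
      = t (\<lambda>i. (p i + m) / c i / c i) n * t (\<lambda>i. p i / c i) (Suc n)
        + m * (t (\<lambda>i. p i * (p i + m) / c i / c i) n * t (\<lambda>i. 1 / c i) (Suc n))"
  proof -
    \<comment> \<open>The set of size \<open>n + 1\<close> carries one more factor
      \<open>- \<delta>\<close> or \<open>- \<epsilon>\<close>; it absorbs the coefficients and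
      leaves only positive signs.\<close>
    have "- \<epsilon> * e * C * (d * D) = e * A * (- \<delta> * d * B) + m * (d * e * F * E)"
      if "- m * (E * F) + \<delta> * (B * A) - \<epsilon> * (C * D) = 0" for A B C D E F d e
      using that by algebra
    from this[OF plucker_mult] show ?thesis unfolding tr pw[symmetric] power_Suc by simp
  qed
  show "t (\<lambda>i. 1 / c i) (Suc n) * t (\<lambda>i. p i / c i) (Suc n)
      = t (\<lambda>_. 1) (Suc n) * t (\<lambda>i. p i / c i / c i) (Suc n)
        + \<delta> * (t (\<lambda>_. 1) (Suc (Suc n)) * t (\<lambda>i. p i / c i / c i) n)"
  proof -
    have "E * (- \<delta> * d * B) = J * (- \<delta> * d * D) + \<delta> * (K * (d * D'))"
      if "J * D = E * B + K * D'" for E B J D K D' d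
      using that by algebra
    from this[OF jac[OF nm(3)]] show ?thesis unfolding tr power_Suc by simp
  qed
  show "t (\<lambda>i. p i * (p i + m) / c i / c i) (Suc n) * t (\<lambda>_. 1) (Suc n)
      = t (\<lambda>i. p i / c i) (Suc n) * t (\<lambda>i. (p i + m) / c i) (Suc n)
        + \<delta> * (\<delta> - m) * (t (\<lambda>_. 1) (Suc (Suc n)) * t (\<lambda>i. p i * (p i + m) / c i / c i) n)"
  proof -
    have "- \<delta> * d * (- \<epsilon> * e) * F * J = - \<delta> * d * B * (- \<epsilon> * e * C) + \<delta> * \<epsilon> * (K * (d * e * F'))"
      if "J * F = B * C + K * F'" for B C J F K F' d e
      using that by algebra
    from this[OF jac[OF nm(4)]] show ?thesis
      unfolding tr \<epsilon>_def[symmetric] unfolding pw[symmetric] unfolding power_Suc by simp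
  qed
  have s5: "s (\<lambda>_. 1) (Suc n) * s (\<lambda>i. (x i - 0) * (x i - ?e) * (x i - ?d)) n
    = - \<epsilon> * (s (\<lambda>i. x i - ?e) (Suc n) * s (\<lambda>i. (x i - 0) * (x i - ?d)) n)
    + \<epsilon> * (s (\<lambda>i. x i - 0) (Suc n) * s (\<lambda>i. (x i - ?d) * (x i - ?e)) n)"
    using pl' \<epsilon> by (simp add: field_simps)
  show "t (\<lambda>_. 1) (Suc n) * t (\<lambda>i. p i * (p i + m) / c i / c i / c i) n
      = t (\<lambda>i. (p i + m) / c i) (Suc n) * t (\<lambda>i. p i / c i / c i) n
        + (\<delta> - m) * (t (\<lambda>i. p i * (p i + m) / c i / c i) n * t (\<lambda>i. 1 / c i) (Suc n))"
  proof -
    have "J * (d * e * G) = - \<epsilon> * e * C * (d * D) + \<epsilon> * (d * e * F * E)"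
      if "J * G = - \<epsilon> * (C * D) + \<epsilon> * (E * F)" for C D E F J G d e
      using that by algebra
    from this[OF s5] show ?thesis unfolding tr pw[symmetric] power_Suc \<epsilon>_def[symmetric] by simp
  qed
qed

end

section \<open>Growth rates and the min-plus limit\<close>

text \<open>Exact order \<open>u^(-a)\<close>, as two-sided bounds on all of
  \<open>u \<ge> 1\<close> instead of a limit of logarithms. The minus sign in the exponent makes
  sums correspond to minima.\<close>

definition has_rate :: "(real \<Rightarrow> real) \<Rightarrow> real \<Rightarrow> bool" where
  "has_rate f a \<longleftrightarrow> (\<exists>c>0. \<exists>C. \<forall>u\<ge>1. c * u powr (- a) \<le> f u \<and> f u \<le> C * u powr (- a))"

lemma has_rateI:
  assumes "c > 0" "\<And>u. 1 \<le> u \<Longrightarrow> c * u powr (- a) \<le> f u" "\<And>u. 1 \<le> u \<Longrightarrow> f u \<le> C * u powr (- a)"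
  shows "has_rate f a"
  unfolding has_rate_def using assms by blast

lemma has_rateE:
  assumes "has_rate f a"
  obtains c C where "c > 0" "C > 0" "\<And>u. 1 \<le> u \<Longrightarrow> c * u powr (- a) \<le> f u"
    "\<And>u. 1 \<le> u \<Longrightarrow> f u \<le> C * u powr (- a)"
proof -
  obtain c C where c: "c > 0" and b: "\<And>u. 1 \<le> u \<Longrightarrow> c * u powr (- a) \<le> f u \<and> f u \<le> C * u powr (- a)"
    using assms unfolding has_rate_def by blast
  have "c \<le> C" using b[of 1] by simp
  then show ?thesis using that[of c C] c b by simp
qed

lemma has_rate_pos: "has_rate f a \<Longrightarrow> 1 \<le> u \<Longrightarrow> 0 < f u"
proof -
  assume "has_rate f a" "1 \<le> u"
  then obtain c where "c > 0" "c * u powr (- a) \<le> f u" by (elim has_rateE) blast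
  moreover have "0 < c * u powr (- a)" using \<open>c > 0\<close> \<open>1 \<le> u\<close> by simp
  ultimately show "0 < f u" by linarith
qed

lemma has_rate_cong:
  "(\<And>u. 1 \<le> u \<Longrightarrow> f u = g u) \<Longrightarrow> has_rate f a \<longleftrightarrow> has_rate g a"
  unfolding has_rate_def by auto

lemma has_rate_powr: "0 < c \<Longrightarrow> has_rate (\<lambda>u. c * u powr (- a)) a"
  by (rule has_rateI[of c _ _ c]) auto

lemma has_rate_mult:
  assumes "has_rate f a" "has_rate g b"
  shows "has_rate (\<lambda>u. f u * g u) (a + b)"
proof -
  obtain c C where 1: "c > 0" "C > 0" "\<And>u. 1 \<le> u \<Longrightarrow> c * u powr (- a) \<le> f u"
    "\<And>u. 1 \<le> u \<Longrightarrow> f u \<le> C * u powr (- a)" using has_rateE[OF assms(1)] by metis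
  obtain d D where 2: "d > 0" "D > 0" "\<And>u. 1 \<le> u \<Longrightarrow> d * u powr (- b) \<le> g u"
    "\<And>u. 1 \<le> u \<Longrightarrow> g u \<le> D * u powr (- b)" using has_rateE[OF assms(2)] by metis
  have eq: "x * y * u powr (- (a + b)) = (x * u powr (- a)) * (y * u powr (- b))" for x y u :: real
    by (simp flip: powr_add)
  show ?thesis
  proof (rule has_rateI[of "c * d" _ _ "C * D"])
    fix u :: real assume u: "1 \<le> u"
    show "c * d * u powr (- (a + b)) \<le> f u * g u" unfolding eq
      by (rule mult_mono) (use 1 2 u has_rate_pos[OF assms(1) u] in auto)
    show "f u * g u \<le> C * D * u powr (- (a + b))" unfolding eq
      by (rule mult_mono) (use 1 2 u has_rate_pos[OF assms(2) u] in auto)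
  qed (use 1 2 in simp)
qed

lemma has_rate_inverse:
  assumes "has_rate f a"
  shows "has_rate (\<lambda>u. 1 / f u) (- a)"
proof -
  obtain c C where 1: "c > 0" "C > 0" "\<And>u. 1 \<le> u \<Longrightarrow> c * u powr (- a) \<le> f u"
    "\<And>u. 1 \<le> u \<Longrightarrow> f u \<le> C * u powr (- a)" using has_rateE[OF assms(1)] by metis
  have eq: "1 / y * u powr (- (- a)) = 1 / (y * u powr (- a))" for y u :: real
    by (simp add: powr_minus_divide)
  show ?thesis
  proof (rule has_rateI[of "1 / C" _ _ "1 / c"])
    fix u :: real assume u: "1 \<le> u"
    have p: "0 < f u" "0 < c * u powr (- a)" using has_rate_pos[OF assms u] 1 u by auto
    show "1 / C * u powr (- (- a)) \<le> 1 / f u" unfolding eq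
      using 1(4)[OF u] p(1) by (intro frac_le) auto
    show "1 / f u \<le> 1 / c * u powr (- (- a))" unfolding eq
      using 1(3)[OF u] p by (intro frac_le) auto
  qed (use 1 in simp)
qed

lemma has_rate_divide:
  assumes "has_rate f a" "has_rate g b"
  shows "has_rate (\<lambda>u. f u / g u) (a - b)"
  using has_rate_mult[OF assms(1) has_rate_inverse[OF assms(2)]] by simp

text \<open>For \<open>u \<ge> 1\<close> the power with the smaller rate dominates, and positivity
  of both functions rules out cancellation.\<close>

lemma has_rate_add:
  assumes "has_rate f a" "has_rate g b"
  shows "has_rate (\<lambda>u. f u + g u) (min a b)"
proof -
  obtain c C where 1: "c > 0" "C > 0" "\<And>u. 1 \<le> u \<Longrightarrow> c * u powr (- a) \<le> f u"
    "\<And>u. 1 \<le> u \<Longrightarrow> f u \<le> C * u powr (- a)" using has_rateE[OF assms(1)] by metis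
  obtain d D where 2: "d > 0" "D > 0" "\<And>u. 1 \<le> u \<Longrightarrow> d * u powr (- b) \<le> g u"
    "\<And>u. 1 \<le> u \<Longrightarrow> g u \<le> D * u powr (- b)" using has_rateE[OF assms(2)] by metis
  show ?thesis
  proof (rule has_rateI[of "min c d" _ _ "C + D"])
    fix u :: real assume u: "1 \<le> u"
    have p: "0 < f u" "0 < g u" using has_rate_pos assms u by blast+
    have "min c d * u powr (- a) \<le> c * u powr (- a)" "min c d * u powr (- b) \<le> d * u powr (- b)"
      by (auto intro: mult_right_mono)
    then show "min c d * u powr (- min a b) \<le> f u + g u"
      using 1(3)[OF u] 2(3)[OF u] p by (cases "a \<le> b") (simp_all add: min_absorb1 min_absorb2)
    have "C * u powr (- a) \<le> C * u powr (- min a b)" "D * u powr (- b) \<le> D * u powr (- min a b)"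
      using 1 2 u by (auto intro!: mult_left_mono powr_mono)
    then show "f u + g u \<le> (C + D) * u powr (- min a b)"
      using 1(4)[OF u] 2(4)[OF u] by (simp add: distrib_right)
  qed (use 1 2 in simp)
qed

lemma has_rate_sum:
  assumes "finite A" "A \<noteq> {}" "\<And>i. i \<in> A \<Longrightarrow> has_rate (f i) (a i)"
  shows "has_rate (\<lambda>u. \<Sum>i\<in>A. f i u) (Min (a ` A))"
  using assms
proof (induction A rule: finite_ne_induct)
  case (insert i A)
  then show ?case using has_rate_add[of "f i" "a i" "\<lambda>u. \<Sum>i\<in>A. f i u" "Min (a ` A)"] by simp
qed simp

lemma has_rate_prod:
  assumes "finite A" "\<And>i. i \<in> A \<Longrightarrow> has_rate (f i) (a i)"
  shows "has_rate (\<lambda>u. \<Prod>i\<in>A. f i u) (\<Sum>i\<in>A. a i)"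
  using assms
proof (induction A rule: finite_induct)
  case empty
  then show ?case using has_rate_powr[of 1 0] by (simp add: has_rate_def)
next
  case (insert i A)
  then show ?case using has_rate_mult[of "f i" "a i" "\<lambda>u. \<Prod>i\<in>A. f i u" "\<Sum>i\<in>A. a i"] by simp
qed

lemma has_rate_le:
  assumes "has_rate f a" "has_rate f b"
  shows "b \<le> a"
proof (rule ccontr)
  assume "\<not> b \<le> a"
  obtain c where c: "c > 0" "\<And>u. 1 \<le> u \<Longrightarrow> c * u powr (- a) \<le> f u"
    using has_rateE[OF assms(1)] by metis
  obtain C where C: "C > 0" "\<And>u. 1 \<le> u \<Longrightarrow> f u \<le> C * u powr (- b)"
    using has_rateE[OF assms(2)] by metis
  \<comment> \<open>Chosen so that \<open>u powr (b - a)\<close> is \<open>1 + C / c\<close>, which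
    exceeds the bound \<open>C / c\<close> forced by the two estimates.\<close>
  define u where "u = (1 + C / c) powr (1 / (b - a))"
  have u: "1 \<le> u" unfolding u_def using c C \<open>\<not> b \<le> a\<close> by (intro ge_one_powr_ge_zero) auto
  have "c * u powr (- a) \<le> C * u powr (- b)" using c C u by force
  then have "c * (u powr (- a) * u powr b) \<le> C * (u powr (- b) * u powr b)"
    using u by (metis mult.assoc mult_right_mono powr_ge_zero)
  then have "c * u powr (b - a) \<le> C" using u by (simp flip: powr_add)
  moreover have "u powr (b - a) = 1 + C / c"
    using c C \<open>\<not> b \<le> a\<close> by (simp add: u_def powr_powr add_pos_pos)
  ultimately show False using c by (simp add: distrib_left)
qed

lemma has_rate_unique: "has_rate f a \<Longrightarrow> has_rate f b \<Longrightarrow> a = b"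
  by (simp add: has_rate_le order_antisym)

section \<open>Min-plus counterparts of the Vandermonde sums\<close>

text \<open>The rate of \<open>pair_weight\<close> when \<open>w i\<close> has rate
  \<open>\<theta> i\<close> and \<open>x i = 1 / c i\<close> with \<open>c i\<close> of rate
  \<open>\<kappa> i\<close>: the difference of two such nodes is a difference of the
  \<open>p\<close> divided by both \<open>c\<close>.\<close>

definition trop_weight :: "('i \<Rightarrow> real) \<Rightarrow> ('i \<Rightarrow> real) \<Rightarrow> ('i \<Rightarrow> real) \<Rightarrow> 'i set \<Rightarrow> real" where
  "trop_weight P \<kappa> \<theta> R = (\<Sum>i\<in>R. \<theta> i + (\<Sum>j\<in>R - {i}. min (P i) (P j) - \<kappa> i - \<kappa> j))"

definition trop_tau :: "'i set \<Rightarrow> ('i \<Rightarrow> real) \<Rightarrow> ('i \<Rightarrow> real) \<Rightarrow> ('i \<Rightarrow> real) \<Rightarrow> nat \<Rightarrow> real" where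
  "trop_tau I P \<kappa> \<theta> k = Min (trop_weight P \<kappa> \<theta> ` nsets I k)"

text \<open>All summands are positive, so the rate of the sum is the minimum of their rates;
  \<open>k \<le> card I\<close> makes the sum nonempty.\<close>

lemma has_rate_tau:
  assumes "finite I" "k \<le> card I" and w: "\<And>i. i \<in> I \<Longrightarrow> has_rate (\<lambda>u. w u i) (\<theta> i)"
    and x: "\<And>i j. i \<in> I \<Longrightarrow> j \<in> I \<Longrightarrow> i \<noteq> j \<Longrightarrow>
      has_rate (\<lambda>u. \<bar>x u i - x u j\<bar>) (min (P i) (P j) - \<kappa> i - \<kappa> j)"
  shows "has_rate (\<lambda>u. tau I (x u) (w u) k) (trop_tau I P \<kappa> \<theta> k)"
  unfolding tau_def trop_tau_def
proof (rule has_rate_sum)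
  show "finite (nsets I k)" using assms by (simp add: finite_imp_finite_nsets)
  obtain S where "S \<subseteq> I" "card S = k" "finite S"
    using obtain_subset_with_card_n[OF assms(2)] by blast
  then show "nsets I k \<noteq> {}" by (auto simp: nsets_def)
  fix R assume "R \<in> nsets I k"
  then have R: "finite R" "R \<subseteq> I" by (auto simp: nsets_def)
  show "has_rate (\<lambda>u. pair_weight (x u) (w u) R) (trop_weight P \<kappa> \<theta> R)"
    unfolding pair_weight_def trop_weight_def
    by (intro has_rate_prod has_rate_mult w x) (use R in auto)
qed

lemma tau_eq_0: "finite I \<Longrightarrow> card I < k \<Longrightarrow> tau I x w k = 0"
proof -
  assume "finite I" "card I < k"
  then have "nsets I k = {}" by (auto simp: nsets_def dest: card_mono)
  then show ?thesis by (simp add: tau_def)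
qed

context
  fixes N :: nat and P \<omega> :: "nat \<Rightarrow> real" and \<Delta> M :: real and \<kappa> \<beta> :: "nat \<Rightarrow> real"
    and V :: "(nat \<Rightarrow> real) \<Rightarrow> nat \<Rightarrow> real"
  assumes mono: "mono_on {..<N} P" and le: "\<Delta> \<le> M"
  defines "\<kappa> \<equiv> \<lambda>i. min (P i) \<Delta>" and "\<beta> \<equiv> \<lambda>i. min (P i) M"
  defines "V \<equiv> \<lambda>h. trop_tau {..<N} P \<kappa> (\<lambda>i. \<omega> i + h i)"
begin

text \<open>Each is the comparison of rates of the two sides of a discrete identity. At
  \<open>Suc n = N\<close> the sum over sets of size \<open>n + 2\<close> is empty, so its term
  drops out of the minimum. Forms such as \<open>0 - \<kappa> i\<close> mirror
  \<open>1 / c u i\<close>.\<close>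

lemma tropical_identities:
  shows "n \<le> N \<Longrightarrow> \<Delta> + (V (\<lambda>i. \<beta> i - \<kappa> i - \<kappa> i) n + V (\<lambda>i. P i - \<kappa> i) n)
      = min (\<Delta> + (V (\<lambda>i. \<beta> i - \<kappa> i) n + V (\<lambda>i. P i - \<kappa> i - \<kappa> i) n))
            (M + (V (\<lambda>i. 0 - \<kappa> i) n + V (\<lambda>i. P i + \<beta> i - \<kappa> i - \<kappa> i) n))"
    and "n < N \<Longrightarrow> V (\<lambda>i. \<beta> i - \<kappa> i) (Suc n) + V (\<lambda>i. P i - \<kappa> i - \<kappa> i) n
      = min (V (\<lambda>i. \<beta> i - \<kappa> i - \<kappa> i) n + V (\<lambda>i. P i - \<kappa> i) (Suc n))
            (M + (V (\<lambda>i. P i + \<beta> i - \<kappa> i - \<kappa> i) n + V (\<lambda>i. 0 - \<kappa> i) (Suc n)))"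
    and "Suc n < N \<Longrightarrow> V (\<lambda>i. 0 - \<kappa> i) (Suc n) + V (\<lambda>i. P i - \<kappa> i) (Suc n)
      = min (V (\<lambda>_. 0) (Suc n) + V (\<lambda>i. P i - \<kappa> i - \<kappa> i) (Suc n))
            (\<Delta> + (V (\<lambda>_. 0) (Suc (Suc n)) + V (\<lambda>i. P i - \<kappa> i - \<kappa> i) n))"
    and "Suc n = N \<Longrightarrow> V (\<lambda>i. 0 - \<kappa> i) (Suc n) + V (\<lambda>i. P i - \<kappa> i) (Suc n)
      = V (\<lambda>_. 0) (Suc n) + V (\<lambda>i. P i - \<kappa> i - \<kappa> i) (Suc n)"
    and "Suc n < N \<Longrightarrow> V (\<lambda>i. P i + \<beta> i - \<kappa> i - \<kappa> i) (Suc n) + V (\<lambda>_. 0) (Suc n)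
      = min (V (\<lambda>i. P i - \<kappa> i) (Suc n) + V (\<lambda>i. \<beta> i - \<kappa> i) (Suc n))
            (\<Delta> + \<Delta> + (V (\<lambda>_. 0) (Suc (Suc n)) + V (\<lambda>i. P i + \<beta> i - \<kappa> i - \<kappa> i) n))"
    and "Suc n = N \<Longrightarrow> V (\<lambda>i. P i + \<beta> i - \<kappa> i - \<kappa> i) (Suc n) + V (\<lambda>_. 0) (Suc n)
      = V (\<lambda>i. P i - \<kappa> i) (Suc n) + V (\<lambda>i. \<beta> i - \<kappa> i) (Suc n)"
    and "n < N \<Longrightarrow> V (\<lambda>_. 0) (Suc n) + V (\<lambda>i. P i + \<beta> i - \<kappa> i - \<kappa> i - \<kappa> i) n
      = min (V (\<lambda>i. \<beta> i - \<kappa> i) (Suc n) + V (\<lambda>i. P i - \<kappa> i - \<kappa> i) n)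
            (\<Delta> + (V (\<lambda>i. P i + \<beta> i - \<kappa> i - \<kappa> i) n + V (\<lambda>i. 0 - \<kappa> i) (Suc n)))"
proof -
  let ?I = "{..<N}"
  \<comment> \<open>The prefactors keep \<open>p\<close> injective if some \<open>P i\<close> coincide, and \<open>\<delta> - m\<close> of order \<open>u\<^sup>-\<^sup>\<Delta>\<close> if
    \<open>M = \<Delta>\<close>.\<close>
  define p where "p u i = (real N - real i) * u powr (- P i)" for u i
  define d where "d u = 2 * u powr (- \<Delta>)" for u :: real
  define m where "m u = 1 * u powr (- M)" for u :: real
  define w where "w u i = 1 * u powr (- \<omega> i)" for u i
  define c where "c u i = p u i + d u" for u i
  define t where "t u h = tau ?I (\<lambda>i. 1 / c u i) (\<lambda>i. w u i * h i)" for u h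
  have p: "has_rate (\<lambda>u. p u i) (P i)" if "i \<in> ?I" for i
    unfolding p_def using that by (intro has_rate_powr) auto
  have d: "has_rate d \<Delta>" and m: "has_rate m M" and w: "has_rate (\<lambda>u. w u i) (\<omega> i)" for i
    unfolding d_def m_def w_def by (intro has_rate_powr; simp)+
  have c: "has_rate (\<lambda>u. c u i) (\<kappa> i)" and b: "has_rate (\<lambda>u. p u i + m u) (\<beta> i)" if "i \<in> ?I" for i
    unfolding c_def \<kappa>_def \<beta>_def by (intro has_rate_add p that d m)+
  have one: "has_rate (\<lambda>_. 1) 0"
    using has_rate_powr[of 1 0] by (simp add: has_rate_def)
  \<comment> \<open>Since \<open>\<Delta> \<le> M\<close>, subtracting \<open>m\<close> removes at
    most half of \<open>d\<close>.\<close>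
  have md: "0 < m u \<and> m u < d u \<and> u powr (- \<Delta>) \<le> d u - m u" if "1 \<le> u" for u
  proof -
    have "u powr (- M) \<le> u powr (- \<Delta>)" using that le by (intro powr_mono) auto
    moreover have "0 < u powr (- M)" "0 < u powr (- \<Delta>)" using that by simp_all
    ultimately show ?thesis unfolding m_def d_def by linarith
  qed
  have dm: "has_rate (\<lambda>u. d u - m u) \<Delta>"
    by (rule has_rateI[of 1 _ _ 2]) (use md in \<open>auto simp: d_def order.strict_implies_order\<close>)
  \<comment> \<open>For \<open>i < j\<close> the prefactors differ by at least 1, and monotonicity
    of \<open>P\<close> makes \<open>u^(-P i)\<close> the larger power; this covers ties as
    well.\<close>
  have diff: "u powr (- P i) \<le> p u i - p u j \<and> p u i - p u j \<le> real N * u powr (- P i)"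
    if "i < j" "j < N" "1 \<le> u" for u i j
  proof -
    have "P i \<le> P j" using that mono by (auto simp: mono_on_def)
    then have "u powr (- P j) \<le> u powr (- P i)" using that by (intro powr_mono) auto
    then have "p u j \<le> (real N - real j) * u powr (- P i)"
      unfolding p_def using that by (intro mult_left_mono) auto
    also have "\<dots> \<le> (real N - real i - 1) * u powr (- P i)"
      using that by (intro mult_right_mono) auto
    finally have 1: "u powr (- P i) \<le> p u i - p u j" by (simp add: p_def algebra_simps)
    have "0 \<le> p u j" "0 \<le> real i * u powr (- P i)" using that by (auto simp: p_def)
    then have "p u i - p u j \<le> real N * u powr (- P i)" unfolding p_def[of u i]
      by (simp add: algebra_simps)
    with 1 show ?thesis by blast
  qed
  have pd: "has_rate (\<lambda>u. \<bar>p u i - p u j\<bar>) (min (P i) (P j))" if "i \<in> ?I" "j \<in> ?I" "i \<noteq> j" for i j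
  proof -
    have *: "has_rate (\<lambda>u. \<bar>p u i - p u j\<bar>) (min (P i) (P j))" if "i < j" "j < N" for i j
    proof (rule has_rateI[of 1 _ _ "real N"])
      have "P i \<le> P j" using that mono by (auto simp: mono_on_def)
      then have eq: "min (P i) (P j) = P i" by simp
      show "1 * u powr (- min (P i) (P j)) \<le> \<bar>p u i - p u j\<bar>"
        "\<bar>p u i - p u j\<bar> \<le> real N * u powr (- min (P i) (P j))" if "1 \<le> u" for u
        unfolding eq using diff[OF \<open>i < j\<close> \<open>j < N\<close> that] powr_ge_zero[of u "- P i"] by linarith+
    qed simp
    show ?thesis using *[of i j] *[of j i] that
      by (cases "i < j") (auto simp: abs_minus_commute min.commute)
  qed
  have xd: "has_rate (\<lambda>u. \<bar>1 / c u i - 1 / c u j\<bar>) (min (P i) (P j) - \<kappa> i - \<kappa> j)"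
    if "i \<in> ?I" "j \<in> ?I" "i \<noteq> j" for i j
  proof -
    have "\<bar>1 / c u i - 1 / c u j\<bar> = \<bar>p u i - p u j\<bar> / c u i / c u j" if "1 \<le> u" for u
    proof -
      have "0 < c u i" "0 < c u j" using has_rate_pos[OF c] \<open>i \<in> ?I\<close> \<open>j \<in> ?I\<close> that by blast+
      then have "1 / c u i - 1 / c u j = (p u j - p u i) / (c u i * c u j)"
        by (simp add: c_def divide_simps)
      then show ?thesis using \<open>0 < c u i\<close> \<open>0 < c u j\<close> by (simp add: abs_mult abs_minus_commute)
    qed
    then show ?thesis
      using has_rate_divide[OF has_rate_divide[OF pd[OF that] c[OF that(1)]] c[OF that(2)]]
        has_rate_cong by (metis (no_types, lifting))
  qed
  have rt: "has_rate (\<lambda>u. t u (h u) k) (V g k)"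
    if "\<And>i. i \<in> ?I \<Longrightarrow> has_rate (\<lambda>u. h u i) (g i)" "k \<le> N" for h g k
    unfolding t_def V_def
    by (rule has_rate_tau) (use that in \<open>auto intro!: has_rate_mult w xd\<close>)
  have inj: "inj_on (p u) ?I" if "1 \<le> u" for u
  proof (rule linorder_inj_onI')
    fix i j assume "i \<in> ?I" "j \<in> ?I" "i < j"
    then show "p u i \<noteq> p u j" using diff[of i j u] that powr_gt_zero[of u "- P i"] by auto
  qed
  have D: "finite ?I" "inj_on (p u) ?I" "i \<in> ?I \<Longrightarrow> 0 < p u i" "0 < m u" "m u < d u" if "1 \<le> u" for u i
    using inj that md[OF that] has_rate_pos[OF p that] by auto
  {
    fix u :: real and n :: nat
    assume u: "1 \<le> u"
    note discrete_identities[of ?I "p u" "m u" "d u" "w u" n,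
        OF D(1)[OF u] D(2)[OF u] D(3)[OF u] D(4)[OF u] D(5)[OF u], folded c_def, folded t_def]
  }
  note id' = this
  have main: "a = a'" if "has_rate f a" "has_rate g a'" "\<And>u. 1 \<le> u \<Longrightarrow> f u = g u" for f g a a'
    using that has_rate_cong[of f g a] has_rate_unique by blast
  \<comment> \<open>These rules compute the rate of either side from its syntax: sums give minima,
    products sums, quotients differences.\<close>
  note rules = has_rate_add has_rate_mult has_rate_divide rt c b p d m dm one
  have zero: "t u h k = 0" if "N < k" for u h k
    unfolding t_def by (rule tau_eq_0) (use that in auto)
  show "n \<le> N \<Longrightarrow> \<Delta> + (V (\<lambda>i. \<beta> i - \<kappa> i - \<kappa> i) n + V (\<lambda>i. P i - \<kappa> i) n)
      = min (\<Delta> + (V (\<lambda>i. \<beta> i - \<kappa> i) n + V (\<lambda>i. P i - \<kappa> i - \<kappa> i) n))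
            (M + (V (\<lambda>i. 0 - \<kappa> i) n + V (\<lambda>i. P i + \<beta> i - \<kappa> i - \<kappa> i) n))"
    by (rule main[rotated 2], rule id'(1)[of _ n], assumption, assumption, (intro rules; simp)+)
  show "n < N \<Longrightarrow> V (\<lambda>i. \<beta> i - \<kappa> i) (Suc n) + V (\<lambda>i. P i - \<kappa> i - \<kappa> i) n
      = min (V (\<lambda>i. \<beta> i - \<kappa> i - \<kappa> i) n + V (\<lambda>i. P i - \<kappa> i) (Suc n))
            (M + (V (\<lambda>i. P i + \<beta> i - \<kappa> i - \<kappa> i) n + V (\<lambda>i. 0 - \<kappa> i) (Suc n)))"
    by (rule main[rotated 2], rule id'(2)[of _ n], assumption, assumption, (intro rules; simp)+)
  show "Suc n < N \<Longrightarrow> V (\<lambda>i. 0 - \<kappa> i) (Suc n) + V (\<lambda>i. P i - \<kappa> i) (Suc n)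
      = min (V (\<lambda>_. 0) (Suc n) + V (\<lambda>i. P i - \<kappa> i - \<kappa> i) (Suc n))
            (\<Delta> + (V (\<lambda>_. 0) (Suc (Suc n)) + V (\<lambda>i. P i - \<kappa> i - \<kappa> i) n))"
    by (rule main[rotated 2], rule id'(3)[of _ n], assumption, assumption, (intro rules; simp)+)
  show "V (\<lambda>i. 0 - \<kappa> i) (Suc n) + V (\<lambda>i. P i - \<kappa> i) (Suc n)
      = V (\<lambda>_. 0) (Suc n) + V (\<lambda>i. P i - \<kappa> i - \<kappa> i) (Suc n)" if "Suc n = N"
  proof -
    have z: "t u h (Suc (Suc n)) = 0" for u h using that by (intro zero) simp
    show ?thesis
      by (rule main[rotated 2], rule id'(3)[of _ n, unfolded z mult_zero_left mult_zero_right add_0_right], assumption, assumption,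
        (intro rules; use that in simp)+)
  qed
  show "Suc n < N \<Longrightarrow> V (\<lambda>i. P i + \<beta> i - \<kappa> i - \<kappa> i) (Suc n) + V (\<lambda>_. 0) (Suc n)
      = min (V (\<lambda>i. P i - \<kappa> i) (Suc n) + V (\<lambda>i. \<beta> i - \<kappa> i) (Suc n))
            (\<Delta> + \<Delta> + (V (\<lambda>_. 0) (Suc (Suc n)) + V (\<lambda>i. P i + \<beta> i - \<kappa> i - \<kappa> i) n))"
    by (rule main[rotated 2], rule id'(4)[of _ n], assumption, assumption, (intro rules; simp)+)
  show "V (\<lambda>i. P i + \<beta> i - \<kappa> i - \<kappa> i) (Suc n) + V (\<lambda>_. 0) (Suc n)
      = V (\<lambda>i. P i - \<kappa> i) (Suc n) + V (\<lambda>i. \<beta> i - \<kappa> i) (Suc n)" if "Suc n = N"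
  proof -
    have z: "t u h (Suc (Suc n)) = 0" for u h using that by (intro zero) simp
    show ?thesis
      by (rule main[rotated 2], rule id'(4)[of _ n, unfolded z mult_zero_left mult_zero_right add_0_right], assumption, assumption,
        (intro rules; use that in simp)+)
  qed
  show "n < N \<Longrightarrow> V (\<lambda>_. 0) (Suc n) + V (\<lambda>i. P i + \<beta> i - \<kappa> i - \<kappa> i - \<kappa> i) n
      = min (V (\<lambda>i. \<beta> i - \<kappa> i) (Suc n) + V (\<lambda>i. P i - \<kappa> i - \<kappa> i) n)
            (\<Delta> + (V (\<lambda>i. P i + \<beta> i - \<kappa> i - \<kappa> i) n + V (\<lambda>i. 0 - \<kappa> i) (Suc n)))"
    by (rule main[rotated 2], rule id'(5)[of _ n], assumption, assumption, (intro rules; simp)+)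
qed

end

section \<open>The ultradiscrete tau functions\<close>

text \<open>For sorted \<open>P\<close> the minimum of a pair is the entry with the smaller index,
  so \<open>P i\<close> occurs twice for each of the \<open>n - 1 - i\<close> later indices, while
  \<open>\<kappa> i\<close> occurs in all \<open>2 * (n - 1)\<close> ordered pairs containing
  \<open>i\<close>.\<close>

lemma sum_pairs_mono:
  fixes P \<kappa> :: "nat \<Rightarrow> real"
  assumes "\<And>i j. i < j \<Longrightarrow> j < n \<Longrightarrow> P i \<le> P j"
  shows "(\<Sum>i<n. \<Sum>j\<in>{..<n} - {i}. min (P i) (P j) - \<kappa> i - \<kappa> j)
    = (\<Sum>i<n. 2 * (real n - 1 - real i) * P i - 2 * (real n - 1) * \<kappa> i)"
  using assms
proof (induction n)
  case (Suc n)
  let ?g = "\<lambda>i j. min (P i) (P j) - \<kappa> i - \<kappa> j"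
  have "(\<Sum>j\<in>{..<Suc n} - {i}. ?g i j) = (\<Sum>j\<in>{..<n} - {i}. ?g i j) + ?g i n" if "i < n" for i
  proof -
    have "{..<Suc n} - {i} = insert n ({..<n} - {i})" using that by auto
    then show ?thesis by simp
  qed
  moreover have "{..<Suc n} - {n} = {..<n}" by auto
  ultimately have "(\<Sum>i<Suc n. \<Sum>j\<in>{..<Suc n} - {i}. ?g i j)
      = (\<Sum>i<n. \<Sum>j\<in>{..<n} - {i}. ?g i j) + (\<Sum>i<n. ?g i n) + (\<Sum>i<n. ?g n i)"
    by (simp add: sum.distrib)
  also have "(\<Sum>i<n. ?g i n) = (\<Sum>i<n. P i - \<kappa> i - \<kappa> n)"
    using Suc.prems by (intro sum.cong) (auto simp: min_def)
  also have "(\<Sum>i<n. ?g n i) = (\<Sum>i<n. P i - \<kappa> i - \<kappa> n)"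
    using Suc.prems by (intro sum.cong) (force simp: min_def)+
  also have "(\<Sum>i<n. \<Sum>j\<in>{..<n} - {i}. ?g i j)
      = (\<Sum>i<n. 2 * (real n - 1 - real i) * P i - 2 * (real n - 1) * \<kappa> i)"
    using Suc by simp
  finally show ?case by (simp add: sum.distrib sum_subtractf algebra_simps sum_distrib_left)
qed simp

text \<open>Every finite set of naturals has an increasing enumeration; this turns minima over
  increasing \<open>r\<close> into minima over subsets.\<close>

lemma image_choices: "(\<lambda>r. r ` {..<n}) ` choices N n = nsets {..<N} n"
proof (intro equalityI subsetI)
  fix R assume "R \<in> (\<lambda>r. r ` {..<n}) ` choices N n"
  then obtain r where "r \<in> choices N n" "R = r ` {..<n}" by blast
  then show "R \<in> nsets {..<N} n"
    by (auto simp: choices_def nsets_def card_image strict_mono_on_imp_inj_on)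
next
  fix R assume R: "R \<in> nsets {..<N} n"
  then obtain h where h: "bij_betw h {..<n} R" "strict_mono_on {..<n} h"
    using ex_bij_betw_strict_mono_card[of R] by (auto simp: nsets_def)
  \<comment> \<open>Members of \<open>choices\<close> are extensional, so the enumeration is made
    undefined outside \<open>{..<n}\<close>.\<close>
  let ?r = "restrict h {..<n}"
  have "?r ` {..<n} = R" using h by (simp add: bij_betw_def)
  moreover have "?r \<in> choices N n"
    using h R by (auto simp: choices_def nsets_def bij_betw_def monotone_on_def)
  ultimately show "R \<in> (\<lambda>r. r ` {..<n}) ` choices N n" by blast
qed

lemma trop_tau_choices:
  assumes mono: "mono_on {..<N} P"
  shows "trop_tau {..<N} P \<kappa> \<theta> n
    = Min ((\<lambda>r. \<Sum>i<n. \<theta> (r i) + 2 * (real n - 1 - real i) * P (r i) - 2 * (real n - 1) * \<kappa> (r i))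
        ` choices N n)"
proof -
  have "trop_weight P \<kappa> \<theta> (r ` {..<n})
      = (\<Sum>i<n. \<theta> (r i) + 2 * (real n - 1 - real i) * P (r i) - 2 * (real n - 1) * \<kappa> (r i))"
    if "r \<in> choices N n" for r
  proof -
    have sm: "strict_mono_on {..<n} r" and range: "\<And>i. i < n \<Longrightarrow> r i < N"
      using that by (auto simp: choices_def)
    have inj: "inj_on r {..<n}" using sm by (rule strict_mono_on_imp_inj_on)
    have "(\<Sum>j\<in>r ` {..<n} - {r i}. min (P (r i)) (P j) - \<kappa> (r i) - \<kappa> j)
        = (\<Sum>j\<in>{..<n} - {i}. min (P (r i)) (P (r j)) - \<kappa> (r i) - \<kappa> (r j))" if "i < n" for i
    proof -
      have "r ` {..<n} - {r i} = r ` ({..<n} - {i})" using inj that by (auto simp: inj_on_def)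
      moreover have "inj_on r ({..<n} - {i})" using inj by (rule inj_on_subset) auto
      ultimately show ?thesis by (simp add: sum.reindex)
    qed
    then have "trop_weight P \<kappa> \<theta> (r ` {..<n}) = (\<Sum>i<n. \<theta> (r i))
        + (\<Sum>i<n. \<Sum>j\<in>{..<n} - {i}. min (P (r i)) (P (r j)) - \<kappa> (r i) - \<kappa> (r j))"
      using inj by (simp add: trop_weight_def sum.reindex sum.distrib)
    also have "(\<Sum>i<n. \<Sum>j\<in>{..<n} - {i}. min (P (r i)) (P (r j)) - \<kappa> (r i) - \<kappa> (r j))
        = (\<Sum>i<n. 2 * (real n - 1 - real i) * P (r i) - 2 * (real n - 1) * \<kappa> (r i))"
    proof (rule sum_pairs_mono[of n "\<lambda>i. P (r i)" "\<lambda>i. \<kappa> (r i)"])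
      fix i j :: nat assume "i < j" "j < n"
      then have "r i < r j" using sm by (auto simp: monotone_on_def)
      then show "P (r i) \<le> P (r j)" using mono range[OF \<open>j < n\<close>] by (auto simp: mono_on_def)
    qed
    finally show ?thesis by (simp add: algebra_simps flip: sum.distrib)
  qed
  then show ?thesis
    unfolding trop_tau_def image_choices[symmetric] image_image by (simp cong: image_cong_simp)
qed

text \<open>The sign convention for negative upper limits is exactly what extends the recursion to
  all integers.\<close>

lemma sum_upto_rec: "sum_upto a t = sum_upto a (t - 1) + a t"
proof (cases "t \<ge> 0")
  case True
  then have "{0..t} = insert t {0..t - 1}" by auto
  with True show ?thesis by (simp add: sum_upto_def)
next
  case False
  then have "{t - 1 + 1..-1} = insert t {t + 1..-1}" by auto
  with False show ?thesis by (auto simp: sum_upto_def)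
qed

lemma trop_tau_0: "trop_tau I P \<kappa> \<theta> 0 = 0"
  by (simp add: trop_tau_def nsets_def trop_weight_def cong: conj_cong)

text \<open>\<open>\<theta>\<close> collects the part of the summand that depends on neither
  \<open>n\<close> nor the position; the rest is the pair interaction in its sorted form.\<close>

lemma T_eq_trop_tau:
  assumes "mono_on {..<N} P" "n \<le> N"
    and "\<And>i. \<theta> i = W i - P i - (of_int t + of_int k) * min (P i) \<Delta> + sum_upto (\<lambda>j. rmin (P i) (M j)) t"
  shows "T N \<Delta> M P W k t (int n) = ereal (trop_tau {..<N} P (\<lambda>i. min (P i) \<Delta>) \<theta> n)"
proof (cases "n = 0")
  case False
  then show ?thesis using assms(2)
    by (simp add: T_def Tmin_def trop_tau_choices[OF assms(1)] assms(3) algebra_simps)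
qed (simp add: T_def trop_tau_0)

lemma Tbar_eq_trop_tau:
  assumes "mono_on {..<N} P" "n \<le> N"
    and "\<And>i. \<theta> i = W i - (of_int t + of_int k) * min (P i) \<Delta> + sum_upto (\<lambda>j. rmin (P i) (M j)) (t - 1)"
  shows "Tbar N \<Delta> M P W k t (int n) = ereal (trop_tau {..<N} P (\<lambda>i. min (P i) \<Delta>) \<theta> n)"
proof (cases "n = 0")
  case False
  then show ?thesis using assms(2)
    by (simp add: Tbar_def Tbarmin_def trop_tau_choices[OF assms(1)] assms(3) algebra_simps)
qed (simp add: Tbar_def trop_tau_0)

lemma trop_tau_cong:
  assumes "\<And>i. i \<in> I \<Longrightarrow> \<theta> i = \<theta>' i"
  shows "trop_tau I P \<kappa> \<theta> k = trop_tau I P \<kappa> \<theta>' k"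
proof -
  have "trop_weight P \<kappa> \<theta> R = trop_weight P \<kappa> \<theta>' R" if "R \<in> nsets I k" for R
    unfolding trop_weight_def using that assms by (intro sum.cong) (auto simp: nsets_def)
  then show ?thesis unfolding trop_tau_def by (simp cong: image_cong_simp)
qed

section \<open>Relations with a possibly infinite bound\<close>

context
  fixes N :: nat and P \<omega> :: "nat \<Rightarrow> real" and \<Delta> :: real and M :: ereal and \<kappa> \<beta> :: "nat \<Rightarrow> real"
    and V :: "(nat \<Rightarrow> real) \<Rightarrow> nat \<Rightarrow> real"
  assumes mono: "mono_on {..<N} P" and le: "ereal \<Delta> \<le> M"
  defines "\<kappa> \<equiv> \<lambda>i. min (P i) \<Delta>" and "\<beta> \<equiv> \<lambda>i. rmin (P i) M"
  defines "V \<equiv> \<lambda>h. trop_tau {..<N} P \<kappa> (\<lambda>i. \<omega> i + h i)"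
begin

text \<open>The first two relations isolate \<open>M\<close>, so that they make sense for infinite
  \<open>M\<close>; the others see \<open>M\<close> only through \<open>\<beta>\<close>.\<close>

lemma tropical_relations:
  shows "n \<le> N \<Longrightarrow> ereal (V (\<lambda>i. \<beta> i - \<kappa> i - \<kappa> i) n + V (\<lambda>i. P i - \<kappa> i) n
          - V (\<lambda>i. 0 - \<kappa> i) n - V (\<lambda>i. P i + \<beta> i - \<kappa> i - \<kappa> i) n + \<Delta>)
      = min (ereal (V (\<lambda>i. \<beta> i - \<kappa> i) n + V (\<lambda>i. P i - \<kappa> i - \<kappa> i) n
          - V (\<lambda>i. 0 - \<kappa> i) n - V (\<lambda>i. P i + \<beta> i - \<kappa> i - \<kappa> i) n + \<Delta>)) M"
    and "n < N \<Longrightarrow> ereal (V (\<lambda>i. \<beta> i - \<kappa> i) (Suc n) + V (\<lambda>i. P i - \<kappa> i - \<kappa> i) n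
          - V (\<lambda>i. P i + \<beta> i - \<kappa> i - \<kappa> i) n - V (\<lambda>i. 0 - \<kappa> i) (Suc n))
      = min (ereal (V (\<lambda>i. \<beta> i - \<kappa> i - \<kappa> i) n + V (\<lambda>i. P i - \<kappa> i) (Suc n)
          - V (\<lambda>i. P i + \<beta> i - \<kappa> i - \<kappa> i) n - V (\<lambda>i. 0 - \<kappa> i) (Suc n))) M"
    and "Suc n < N \<Longrightarrow> V (\<lambda>i. 0 - \<kappa> i) (Suc n) + V (\<lambda>i. P i - \<kappa> i) (Suc n)
      = min (V (\<lambda>_. 0) (Suc n) + V (\<lambda>i. P i - \<kappa> i - \<kappa> i) (Suc n))
            (\<Delta> + (V (\<lambda>_. 0) (Suc (Suc n)) + V (\<lambda>i. P i - \<kappa> i - \<kappa> i) n))"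
    and "Suc n = N \<Longrightarrow> V (\<lambda>i. 0 - \<kappa> i) (Suc n) + V (\<lambda>i. P i - \<kappa> i) (Suc n)
      = V (\<lambda>_. 0) (Suc n) + V (\<lambda>i. P i - \<kappa> i - \<kappa> i) (Suc n)"
    and "Suc n < N \<Longrightarrow> V (\<lambda>i. P i + \<beta> i - \<kappa> i - \<kappa> i) (Suc n) + V (\<lambda>_. 0) (Suc n)
      = min (V (\<lambda>i. P i - \<kappa> i) (Suc n) + V (\<lambda>i. \<beta> i - \<kappa> i) (Suc n))
            (\<Delta> + \<Delta> + (V (\<lambda>_. 0) (Suc (Suc n)) + V (\<lambda>i. P i + \<beta> i - \<kappa> i - \<kappa> i) n))"
    and "Suc n = N \<Longrightarrow> V (\<lambda>i. P i + \<beta> i - \<kappa> i - \<kappa> i) (Suc n) + V (\<lambda>_. 0) (Suc n)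
      = V (\<lambda>i. P i - \<kappa> i) (Suc n) + V (\<lambda>i. \<beta> i - \<kappa> i) (Suc n)"
    and "n < N \<Longrightarrow> V (\<lambda>_. 0) (Suc n) + V (\<lambda>i. P i + \<beta> i - \<kappa> i - \<kappa> i - \<kappa> i) n
      = min (V (\<lambda>i. \<beta> i - \<kappa> i) (Suc n) + V (\<lambda>i. P i - \<kappa> i - \<kappa> i) n)
            (\<Delta> + (V (\<lambda>i. P i + \<beta> i - \<kappa> i - \<kappa> i) n + V (\<lambda>i. 0 - \<kappa> i) (Suc n)))"
proof -
  \<comment> \<open>An infinite \<open>M\<close> acts on the \<open>P i\<close> like any real bound above all of them.\<close>
  define M' where "M' = (if M = \<infinity> then Max (insert \<Delta> (P ` {..<N})) else real_of_ereal M)"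
  have M': "M = \<infinity> \<or> M = ereal M'" and \<Delta>M: "\<Delta> \<le> M'"
    using le by (cases M; auto simp: M'_def)+
  have \<beta>: "\<beta> i = min (P i) M'" if "i \<in> {..<N}" for i
  proof (cases "M = \<infinity>")
    case True
    then have "P i \<le> M'" using that by (simp add: M'_def)
    then show ?thesis using True by (simp add: \<beta>_def rmin_def)
  next
    case False
    then have "M = ereal M'" using M' by blast
    then show ?thesis by (auto simp: \<beta>_def rmin_def min_def)
  qed
  have V: "V (\<lambda>i. \<beta> i - \<kappa> i - \<kappa> i) = V (\<lambda>i. min (P i) M' - \<kappa> i - \<kappa> i)"
    "V (\<lambda>i. \<beta> i - \<kappa> i) = V (\<lambda>i. min (P i) M' - \<kappa> i)"
    "V (\<lambda>i. P i + \<beta> i - \<kappa> i - \<kappa> i) = V (\<lambda>i. P i + min (P i) M' - \<kappa> i - \<kappa> i)"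
    "V (\<lambda>i. P i + \<beta> i - \<kappa> i - \<kappa> i - \<kappa> i) = V (\<lambda>i. P i + min (P i) M' - \<kappa> i - \<kappa> i - \<kappa> i)"
    unfolding V_def by (intro ext trop_tau_cong; simp add: \<beta>)+
  have fold_\<kappa>: "min (P i) \<Delta> = \<kappa> i" for i by (simp add: \<kappa>_def)
  have fold_V: "trop_tau {..<N} P \<kappa> (\<lambda>i. \<omega> i + h i) = V h" for h by (simp add: V_def)
  note id = tropical_identities[OF mono \<Delta>M, of _ \<omega>, unfolded fold_\<kappa>, unfolded fold_V, folded V]
  \<comment> \<open>With \<open>\<beta> = P\<close> the two finite expressions in each of the first
    two relations coincide.\<close>
  have \<beta>_inf: "\<beta> = P" if "M = \<infinity>" using that by (simp add: \<beta>_def rmin_def fun_eq_iff)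
  have real: "ereal (a - x + \<Delta>) = min (ereal (b - x + \<Delta>)) (ereal c)"
    if "\<Delta> + a = min (\<Delta> + b) (c + x)" for a b c x
    using that by (auto simp: min_def split: if_splits)
  show "ereal (V (\<lambda>i. \<beta> i - \<kappa> i - \<kappa> i) n + V (\<lambda>i. P i - \<kappa> i) n
          - V (\<lambda>i. 0 - \<kappa> i) n - V (\<lambda>i. P i + \<beta> i - \<kappa> i - \<kappa> i) n + \<Delta>)
      = min (ereal (V (\<lambda>i. \<beta> i - \<kappa> i) n + V (\<lambda>i. P i - \<kappa> i - \<kappa> i) n
          - V (\<lambda>i. 0 - \<kappa> i) n - V (\<lambda>i. P i + \<beta> i - \<kappa> i - \<kappa> i) n + \<Delta>)) M" if "n \<le> N"
  proof (cases "M = \<infinity>")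
    case False
    then show ?thesis using real[OF id(1)[OF that]] M' by (simp add: diff_diff_eq)
  qed (simp add: \<beta>_inf)
  show "ereal (V (\<lambda>i. \<beta> i - \<kappa> i) (Suc n) + V (\<lambda>i. P i - \<kappa> i - \<kappa> i) n
          - V (\<lambda>i. P i + \<beta> i - \<kappa> i - \<kappa> i) n - V (\<lambda>i. 0 - \<kappa> i) (Suc n))
      = min (ereal (V (\<lambda>i. \<beta> i - \<kappa> i - \<kappa> i) n + V (\<lambda>i. P i - \<kappa> i) (Suc n)
          - V (\<lambda>i. P i + \<beta> i - \<kappa> i - \<kappa> i) n - V (\<lambda>i. 0 - \<kappa> i) (Suc n))) M" if "n < N"
  proof (cases "M = \<infinity>")
    case False
    then show ?thesis using id(2)[OF that] M' by (auto simp: min_def split: if_splits)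
  qed (simp add: \<beta>_inf)
  show "Suc n < N \<Longrightarrow> V (\<lambda>i. 0 - \<kappa> i) (Suc n) + V (\<lambda>i. P i - \<kappa> i) (Suc n)
      = min (V (\<lambda>_. 0) (Suc n) + V (\<lambda>i. P i - \<kappa> i - \<kappa> i) (Suc n))
            (\<Delta> + (V (\<lambda>_. 0) (Suc (Suc n)) + V (\<lambda>i. P i - \<kappa> i - \<kappa> i) n))"
    by (fact id(3))
  show "Suc n = N \<Longrightarrow> V (\<lambda>i. 0 - \<kappa> i) (Suc n) + V (\<lambda>i. P i - \<kappa> i) (Suc n)
      = V (\<lambda>_. 0) (Suc n) + V (\<lambda>i. P i - \<kappa> i - \<kappa> i) (Suc n)"
    by (fact id(4))
  show "Suc n < N \<Longrightarrow> V (\<lambda>i. P i + \<beta> i - \<kappa> i - \<kappa> i) (Suc n) + V (\<lambda>_. 0) (Suc n)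
      = min (V (\<lambda>i. P i - \<kappa> i) (Suc n) + V (\<lambda>i. \<beta> i - \<kappa> i) (Suc n))
            (\<Delta> + \<Delta> + (V (\<lambda>_. 0) (Suc (Suc n)) + V (\<lambda>i. P i + \<beta> i - \<kappa> i - \<kappa> i) n))"
    by (fact id(5))
  show "Suc n = N \<Longrightarrow> V (\<lambda>i. P i + \<beta> i - \<kappa> i - \<kappa> i) (Suc n) + V (\<lambda>_. 0) (Suc n)
      = V (\<lambda>i. P i - \<kappa> i) (Suc n) + V (\<lambda>i. \<beta> i - \<kappa> i) (Suc n)"
    by (fact id(6))
  show "n < N \<Longrightarrow> V (\<lambda>_. 0) (Suc n) + V (\<lambda>i. P i + \<beta> i - \<kappa> i - \<kappa> i - \<kappa> i) n
      = min (V (\<lambda>i. \<beta> i - \<kappa> i) (Suc n) + V (\<lambda>i. P i - \<kappa> i - \<kappa> i) n)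
            (\<Delta> + (V (\<lambda>i. P i + \<beta> i - \<kappa> i - \<kappa> i) n + V (\<lambda>i. 0 - \<kappa> i) (Suc n)))"
    by (fact id(7))
qed

end

section \<open>Verification of the system\<close>

lemma T_ends: "T N \<Delta> M P W k t (int N + 1) = \<infinity>" "Tbar N \<Delta> M P W k t (- 1) = \<infinity>"
  "Tbar N \<Delta> M P W k t (int N + 1) = \<infinity>"
  by (simp_all add: T_def Tbar_def)

text \<open>Since \<open>e - max 0 (d - D)\<close> is \<open>min e (e - d + D)\<close>, the right
  side is a minimum of three terms. Solving the first assumption for \<open>b\<close> and inserting
  it into the second yields the same three.\<close>

lemma site_update:
  fixes a :: real
  assumes "f + b = min (a' + g) (d + (a2 + g0))" "b' + a' = min (b + a) (d + d + (a2 + b0))"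
  shows "b' - b0 + g0 - g
    = min (a2 - a' + g0 - g + 2 * d - max 0 (d - (a - b0 + g0 - f))) (a - b0 + g0 - f)"
  using assms unfolding min_def max_def by (simp split: if_splits)

theorem theorem5:
  fixes N :: nat and \<Delta> :: real and M :: "int \<Rightarrow> ereal" and P W :: "nat \<Rightarrow> real"
    and \<T> \<T>b :: "int \<Rightarrow> int \<Rightarrow> int \<Rightarrow> ereal"
    and Q Qb E Eb Cb Db :: "int \<Rightarrow> int \<Rightarrow> ereal"
  assumes "N \<ge> 1"
    and "\<And>t. M t \<noteq> -\<infinity>"
    and "\<And>t. ereal \<Delta> \<le> M (t + 1)"
    and "mono_on {..<N} P"
    and "\<T> = T N \<Delta> M P W" and "\<T>b = Tbar N \<Delta> M P W"
    and "\<And>t n. 0 \<le> n \<Longrightarrow> n \<le> int N - 1 \<Longrightarrow>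
           Q t n = \<T>b 0 (t+1) (n+1) - \<T>b 0 (t+1) n + \<T> 1 t n - \<T> 1 t (n+1)"
    and "\<And>t n. 0 \<le> n \<Longrightarrow> n \<le> int N - 1 \<Longrightarrow>
           Qb t n = \<T>b 0 (t+1) (n+1) - \<T>b 0 (t+1) n + \<T>b 1 t n - \<T>b 1 t (n+1)"
    and "\<And>t n. 0 \<le> n \<Longrightarrow> n \<le> int N \<Longrightarrow>
           E t n = \<T> 0 t (n+1) - \<T> 0 t n + \<T>b 1 (t+1) (n-1) - \<T>b 1 (t+1) n + 2 * ereal \<Delta>"
    and "\<And>t n. 0 \<le> n \<Longrightarrow> n \<le> int N \<Longrightarrow>
           Eb t n = \<T>b 0 t (n+1) - \<T>b 0 t n + \<T>b 1 (t+1) (n-1) - \<T>b 1 (t+1) n + 2 * ereal \<Delta>"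
    and "\<And>t n. 0 \<le> n \<Longrightarrow> n \<le> int N \<Longrightarrow>
           Cb t n = \<T>b 0 t n - \<T>b 0 (t+1) n + \<T> 1 t n - \<T> 1 (t-1) n + ereal \<Delta>"
    and "\<And>t n. 0 \<le> n \<Longrightarrow> n \<le> int N - 1 \<Longrightarrow>
           Db t n = \<T> 0 t (n+1) - \<T>b 0 (t+1) n + \<T>b 1 t n - \<T> 1 (t-1) (n+1)"
  shows "ud_system N \<Delta> M Q Qb E Eb Cb Db"
proof -
  note mono = assms(4) and T_def' = assms(5) and Tb_def' = assms(6)
  have Tex: "\<exists>a. \<T> k t (int j) = ereal a" "\<exists>a. \<T>b k t (int j) = ereal a" if "j \<le> N" for k t j
    unfolding T_def' Tb_def' using T_eq_trop_tau[OF mono that refl] Tbar_eq_trop_tau[OF mono that refl]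
    by blast+
  have ends: "\<T> k t (int N + 1) = \<infinity>" "\<T>b k t (- 1) = \<infinity>" "\<T>b k t (int N + 1) = \<infinity>" for k t
    by (simp_all add: T_def' Tb_def' T_ends)
  have two: "2 * ereal \<Delta> = ereal (2 * \<Delta>)" by simp
  \<comment> \<open>Exactly one of the terms is infinite: the one with index \<open>-1\<close> here,
    and those with index \<open>N + 1\<close> at the other end.\<close>
  have E0: "E t 0 = \<infinity>" and Eb0: "Eb t 0 = \<infinity>" for t
    using Tex[of 0 0 t] Tex[of 1 0 t] Tex(2)[of 0 1 "t + 1"] Tex[OF assms(1), of 0 t] ends(2)[of 1 "t + 1"]
    by (auto simp: assms(9,10) two)
  have EN: "E t (int N) = \<infinity>" and EbN: "Eb t (int N) = \<infinity>" for t
  proof -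
    obtain a b c d where "\<T> 0 t (int N) = ereal a" "\<T>b 0 t (int N) = ereal b"
      "\<T>b 1 (t + 1) (int N - 1) = ereal c" "\<T>b 1 (t + 1) (int N) = ereal d"
      using Tex[of N 0 t] Tex(2)[of "N - 1" 1 "t + 1"] Tex(2)[of N 1 "t + 1"] assms(1)
      by (auto simp: of_nat_diff)
    then show "E t (int N) = \<infinity>" "Eb t (int N) = \<infinity>" by (auto simp: assms(9,10) ends two)
  qed
  show ?thesis unfolding ud_system_def
  proof (intro allI conjI impI)
    fix t
    define \<kappa> where "\<kappa> i = min (P i) \<Delta>" for i
    define \<beta> where "\<beta> i = rmin (P i) (M (t + 1))" for i
    \<comment> \<open>The site weight of \<open>T 0 t\<close>. Relative to it, a time step adds
      \<open>\<beta> - \<kappa>\<close>, raising \<open>k\<close> from 0 to 1 adds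
      \<open>- \<kappa>\<close>, and passing from \<open>T\<close> to \<open>Tbar\<close> one step
      later adds \<open>P - \<kappa>\<close>.\<close>
    define \<omega> where "\<omega> i = W i - P i - of_int t * \<kappa> i + sum_upto (\<lambda>j. rmin (P i) (M j)) t" for i
    define V where "V h = trop_tau {..<N} P \<kappa> (\<lambda>i. \<omega> i + h i)" for h
    have su: "sum_upto (\<lambda>j. rmin (P i) (M j)) (t + 1) = sum_upto (\<lambda>j. rmin (P i) (M j)) t + \<beta> i" for i
      using sum_upto_rec[of _ "t + 1"] by (simp add: \<beta>_def)
    \<comment> \<open>\<open>A, B, F, G\<close> stand for \<open>T 0\<close>, \<open>Tbar 0\<close>, \<open>T 1\<close>, \<open>Tbar 1\<close> at neighbouring times; \<open>H\<close> is \<open>G\<close> one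
      step later.\<close>
    define A' where "A' = V (\<lambda>_. 0)"
    define A where "A = V (\<lambda>i. \<beta> i - \<kappa> i)"
    define B where "B = V (\<lambda>i. P i - \<kappa> i)"
    define B' where "B' = V (\<lambda>i. P i + \<beta> i - \<kappa> i - \<kappa> i)"
    define F where "F = V (\<lambda>i. 0 - \<kappa> i)"
    define F' where "F' = V (\<lambda>i. \<beta> i - \<kappa> i - \<kappa> i)"
    define G where "G = V (\<lambda>i. P i - \<kappa> i - \<kappa> i)"
    define H where "H = V (\<lambda>i. P i + \<beta> i - \<kappa> i - \<kappa> i - \<kappa> i)"
    note defs = A'_def A_def B_def B'_def F_def F'_def G_def H_def
    have vals: "\<T> 0 t (int j) = ereal (A' j)" "\<T> 0 (t + 1) (int j) = ereal (A j)"
      "\<T>b 0 (t + 1) (int j) = ereal (B j)" "\<T>b 0 (t + 2) (int j) = ereal (B' j)"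
      "\<T> 1 t (int j) = ereal (F j)" "\<T> 1 (t + 1) (int j) = ereal (F' j)"
      "\<T>b 1 (t + 1) (int j) = ereal (G j)" "\<T>b 1 (t + 2) (int j) = ereal (H j)" if "j \<le> N" for j
      unfolding T_def' Tb_def' defs V_def \<kappa>_def[abs_def]
      by (rule T_eq_trop_tau[OF mono that] Tbar_eq_trop_tau[OF mono that];
          use su su[unfolded add.commute[of t 1]] in \<open>simp add: \<omega>_def \<kappa>_def algebra_simps\<close>)+
    note rel = tropical_relations[OF mono assms(3)[of t], where \<omega> = \<omega>, folded \<kappa>_def \<beta>_def, folded V_def, folded defs]
    \<comment> \<open>\<open>rel1\<close> will give the equation for \<open>Cb\<close>,
      \<open>rel2\<close> that for \<open>Db\<close>, \<open>rel3\<close> with \<open>rel4\<close>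
      that for \<open>Qb\<close>, and \<open>rel5\<close> that for \<open>Eb\<close>.\<close>
    have rel1: "ereal (F' n + B n - F n - B' n + \<Delta>) = min (ereal (A n + G n - F n - B' n + \<Delta>)) (M (t + 1))"
      if "n \<le> N" for n
      by (rule rel(1)[OF that])
    have rel2: "ereal (A (Suc n) + G n - B' n - F (Suc n))
        = min (ereal (F' n + B (Suc n) - B' n - F (Suc n))) (M (t + 1))" if "n < N" for n
      by (rule rel(2)[OF that])
    have rel3: "F (Suc n) + B (Suc n) = (if Suc n = N then A' (Suc n) + G (Suc n)
        else min (A' (Suc n) + G (Suc n)) (\<Delta> + (A' (Suc (Suc n)) + G n)))" if "n < N" for n
      using rel(3,4)[of n] that by simp
    have rel4: "B' (Suc n) + A' (Suc n) = (if Suc n = N then B (Suc n) + A (Suc n)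
        else min (B (Suc n) + A (Suc n)) (\<Delta> + \<Delta> + (A' (Suc (Suc n)) + B' n)))" if "n < N" for n
      using rel(5,6)[of n] that by simp
    have rel5: "A' (Suc n) + H n = min (A (Suc n) + G n) (\<Delta> + (B' n + F (Suc n)))" if "n < N" for n
      by (rule rel(7)[OF that])
    have suc: "int j + 1 = int (Suc j)" "int (Suc j) - 1 = int j" for j by simp_all
    have to_real: "max 0 (ereal a) = ereal (max 0 a)" "min (ereal a) (ereal b) = ereal (min a b)"
      "ereal a - ereal b = ereal (a - b)" "ereal a + ereal b = ereal (a + b)" for a b
      by (simp_all add: max_def min_def)
    \<comment> \<open>The minimum in \<open>rel5\<close> turns this maximum into a linear
      expression, which makes the equation for \<open>Eb\<close> a plain cancellation.\<close>
    have mx: "max 0 (\<Delta> - (A (Suc j) - B' j + G j - F (Suc j))) = \<Delta> + B' j + F (Suc j) - A' (Suc j) - H j"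
      if "j < N" for j
      using rel5[OF that] by (simp add: max_def min_def split: if_splits)
    have t2: "t + 1 + 1 = t + 2" by simp
    have vQ: "Q t (int j) = ereal (B (Suc j) - B j + F j - F (Suc j))"
      and vQ': "Q (t + 1) (int j) = ereal (B' (Suc j) - B' j + F' j - F' (Suc j))"
      and vQb: "Qb (t + 1) (int j) = ereal (B' (Suc j) - B' j + G j - G (Suc j))"
      and vD: "Db (t + 1) (int j) = ereal (A (Suc j) - B' j + G j - F (Suc j))" if "j < N" for j
      using that vals[of j] vals[of "Suc j"] by (simp_all add: assms(7,8,12) t2 suc del: of_nat_Suc)
    have vE: "E t (int (Suc j)) = ereal (A' (Suc (Suc j)) - A' (Suc j) + G j - G (Suc j) + 2 * \<Delta>)"
      and vE': "E (t + 1) (int (Suc j)) = ereal (A (Suc (Suc j)) - A (Suc j) + H j - H (Suc j) + 2 * \<Delta>)"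
      and vEb: "Eb (t + 1) (int (Suc j)) = ereal (B (Suc (Suc j)) - B (Suc j) + H j - H (Suc j) + 2 * \<Delta>)"
      if "Suc j < N" for j
      using that vals[of j] vals[of "Suc j"] vals[of "Suc (Suc j)"]
      by (simp_all add: assms(9,10) t2 suc two del: of_nat_Suc)
    have vC: "Cb (t + 1) (int j) = ereal (B j - B' j + F' j - F j + \<Delta>)" if "j \<le> N" for j
      using that vals[of j] by (simp add: assms(11) t2)
    {
      fix n assume n: "0 \<le> n \<and> n \<le> int N - 1"
      define j where "j = nat n"
      have j: "n = int j" "j < N" using n unfolding j_def by linarith+
      show "Qb (t + 1) n = min (E t (n + 1) - max 0 (ereal \<Delta> - Db (t + 1) n)) (Db (t + 1) n)"
      proof (cases "Suc j = N")
        \<comment> \<open>At the last site \<open>E\<close> is infinite, so the minimum is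
          \<open>Db\<close>; accordingly \<open>rel3\<close> and \<open>rel4\<close> have lost their
          second alternatives.\<close>
        case True
        then show ?thesis using rel3[of j] rel4[of j] EN[of t] j
          by (simp add: vQb vD suc max_def)
      next
        case False
        then have "j < N" "Suc j < N" using j by auto
        have "F (Suc j) + B (Suc j) = min (A' (Suc j) + G (Suc j)) (\<Delta> + (A' (Suc (Suc j)) + G j))"
          "B' (Suc j) + A' (Suc j) = min (B (Suc j) + A (Suc j)) (\<Delta> + \<Delta> + (A' (Suc (Suc j)) + B' j))"
          using rel3[of j] rel4[of j] False j(2) by simp_all
        from site_update[OF this] show ?thesis
          unfolding j(1) suc vQb[OF \<open>j < N\<close>] vD[OF \<open>j < N\<close>] vE[OF \<open>Suc j < N\<close>] to_real
          by simp
      qed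
      show "Db (t + 1) n = min (Cb (t + 1) n + Q t n - ereal \<Delta>) (M (t + 1))"
      proof -
        have "Cb (t + 1) n + Q t n - ereal \<Delta> = ereal (F' j + B (Suc j) - B' j - F (Suc j))"
          using j by (simp add: vC vQ)
        moreover have "Db (t + 1) n = ereal (A (Suc j) + G j - B' j - F (Suc j))"
          using j by (simp add: vD)
        ultimately show ?thesis using rel2[OF j(2)] by simp
      qed
      \<comment> \<open>The values at time \<open>t\<close> cancel identically; no relation is
        involved.\<close>
      show "Q (t + 1) n = Q t n + Cb (t + 1) n - Cb (t + 1) (n + 1)"
        using j by (simp add: vQ vQ' vC suc del: of_nat_Suc)
    next
      fix n assume n: "1 \<le> n \<and> n \<le> int N - 1"
      define j where "j = nat (n - 1)"
      have j: "n = int (Suc j)" "Suc j < N" using n unfolding j_def by linarith+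
      show "Eb (t + 1) n = E t n - Qb (t + 1) (n - 1) + Q t n
          - max 0 (ereal \<Delta> - Db (t + 1) (n - 1)) + max 0 (ereal \<Delta> - Db (t + 1) n)"
        unfolding j(1) suc vQb[OF Suc_lessD[OF j(2)]] vD[OF Suc_lessD[OF j(2)]] vD[OF j(2)]
          vQ[OF j(2)] vE[OF j(2)] vEb[OF j(2)] to_real mx[OF j(2)] mx[OF Suc_lessD[OF j(2)]]
        by simp
      show "E (t + 1) n = Eb (t + 1) n + Qb (t + 1) (n - 1) - Q t n - Db (t + 1) (n - 1) + Db (t + 1) n"
        using j by (simp add: vE' vEb vQb vQ vD suc del: of_nat_Suc)
    next
      fix n assume n: "1 \<le> n \<and> n \<le> int N"
      define j where "j = nat (n - 1)"
      have j: "n = int (Suc j)" "j < N" using n unfolding j_def by linarith+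
      show "Cb (t + 1) n = min (Db (t + 1) (n - 1) - Qb (t + 1) (n - 1) + ereal \<Delta>) (M (t + 1))"
      proof -
        \<comment> \<open>The values at site \<open>j\<close> cancel, leaving an expression at
          \<open>Suc j\<close> alone, as in \<open>rel1\<close>.\<close>
        have "Db (t + 1) (n - 1) - Qb (t + 1) (n - 1) + ereal \<Delta>
            = ereal (A (Suc j) + G (Suc j) - F (Suc j) - B' (Suc j) + \<Delta>)"
          using j by (simp add: vD vQb suc del: of_nat_Suc)
        moreover have "Cb (t + 1) n = ereal (F' (Suc j) + B (Suc j) - F (Suc j) - B' (Suc j) + \<Delta>)"
          using j by (simp add: vC del: of_nat_Suc)
        ultimately show ?thesis using rel1[of "Suc j"] j(2) by simp
      qed
    }
    show "E t 0 = \<infinity>" "E t (int N) = \<infinity>" "Eb t 0 = \<infinity>" "Eb t (int N) = \<infinity>" by (fact E0 EN Eb0 EbN)+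
    show "Cb (t + 1) 0 = ereal \<Delta>" using vC[of 0] by (simp add: defs V_def trop_tau_0)
  qed
qed

end
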